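(* Let $B=\{B_t,t\ge0\}$ be a standard one-dimensional Brownian motion started at $0$ and let $L_t^a$ be its local time at level $a$. For $t>0$ and $a\in\mathbb{R}$, the joint distribution of $(B_t,L_t^a)$ is $$\begin{aligned}P\big(B_t\in dy,\,L_t^a\in dv\big)=1_{\{v\ge0\}}\Big[&\frac{|a|+|y-a|+v}{\sqrt{2\pi t^3}}\exp\Big(-\frac{(|a|+|y-a|+v)^2}{2t}\Big)\\&+\frac{1}{\sqrt{2\pi t}}\Big(e^{-\frac{y^2}{2t}}-e^{-\frac{(2a-y)^2}{2t}}\Big)1_{\{\mathrm{sign}(a)y\le|a|\}}\,\delta_0(v)\Big]\,dy\,dv,\end{aligned}$$ where $\mathrm{sign}(a)=1$ if $a\ge0$ and $\mathrm{sign}(a)=-1$ if $a<0$.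
   Context: The local time is normalized as the occupation density with respect to Lebesgue measure, $L_t^a=\int_0^t\delta_a(B_s)\,ds$, i.e. $\int_0^tg(B_s)\,ds=\int_{\mathbb{R}}g(a)L_t^a\,da$ for bounded measurable $g$. The symbol $\delta_0(v)\,dv$ denotes the Dirac unit mass at $v=0$, whose atom at $0$ counts in full on $\{v\ge 0\}$. *)

theory Defs
  imports "HOL-Probability.Probability"
begin

text \<open>Times are real numbers; values of the processes at negative times are irrelevant.\<close>

locale standard_brownian_motion = prob_space M
  for M :: "'w measure" +
  fixes B :: "real \<Rightarrow> 'w \<Rightarrow> real"
  assumes random_variable_B: "0 \<le> t \<Longrightarrow> random_variable borel (B t)"
    and starts_at_0: "AE \<omega> in M. B 0 \<omega> = 0"
    and independent_increments:
      "0 \<le> \<tau> 0 \<Longrightarrow> strict_mono_on {..n} \<tau> \<Longrightarrow>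
        indep_vars (\<lambda>_. borel) (\<lambda>i \<omega>. B (\<tau> (Suc i)) \<omega> - B (\<tau> i) \<omega>) {..<n::nat}"
    and gaussian_increments:
      "0 \<le> s \<Longrightarrow> s < t \<Longrightarrow>
        distributed M lborel (\<lambda>\<omega>. B t \<omega> - B s \<omega>) (normal_density 0 (sqrt (t - s)))"
    and continuous_paths: "AE \<omega> in M. continuous_on {0..} (\<lambda>t. B t \<omega>)"

text \<open>
  \<open>L t a\<close> is the local time at level \<open>a\<close> up to time \<open>t\<close>.  The occupation formula alone
  determines \<open>a \<mapsto> L t a \<omega>\<close> only up to Lebesgue null sets, so that it says nothing about a
  single level; as usual, local time is its version that is jointly continuous in time and
  level (which exists by Trotter's theorem).  The use of \<open>has_bochner_integral\<close> makes the
  integrability of \<open>L t\<close> part of the occupation formula.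
\<close>

locale brownian_local_time = standard_brownian_motion M B
  for M :: "'w measure" and B :: "real \<Rightarrow> 'w \<Rightarrow> real" +
  fixes L :: "real \<Rightarrow> real \<Rightarrow> 'w \<Rightarrow> real"
  assumes random_variable_L: "0 \<le> t \<Longrightarrow> random_variable borel (L t a)"
    and continuous_L: "AE \<omega> in M. continuous_on ({0..} \<times> UNIV) (\<lambda>(t, a). L t a \<omega>)"
    and occupation_formula:
      "AE \<omega> in M. \<forall>t\<ge>0. \<forall>g\<in>borel_measurable borel. bounded (range g) \<longrightarrow>
        has_bochner_integral lborel (\<lambda>a. g a * L t a \<omega>) (LBINT s:{0..t}. g (B s \<omega>))"

text \<open>In contrast to \<^const>\<open>sgn\<close>, this sign is \<open>1\<close> at \<open>0\<close>.\<close>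

definition level_sign :: "real \<Rightarrow> real" where
  "level_sign a = (if a \<ge> 0 then 1 else -1)"

end

theory Submission
  imports Defs "HOL-Real_Asymp.Real_Asymp"
begin

text \<open>
  Local time at the level \<open>a\<close> is the limit of the occupation times
  \<open>A = \<integral>\<^sub>0\<^sup>t \<phi>(B\<^sub>s) ds\<close> of bumps \<open>\<phi>\<close> of mass one that shrink to \<open>a\<close>.  By the Markov
  property, the density at \<open>y\<close> of \<open>E(A\<^sup>n / n!; B\<^sub>t \<in> dy)\<close> is an integral over the times
  \<open>s\<^sub>1 < \<dots> < s\<^sub>n\<close> and the places \<open>x\<^sub>1, \<dots>, x\<^sub>n\<close> of \<open>n\<close> visits to the bump: of
  \<open>\<phi>(x\<^sub>1) \<dots> \<phi>(x\<^sub>n)\<close> times the product of the heat kernels along the way from \<open>0\<close> through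
  \<open>x\<^sub>1, \<dots>, x\<^sub>n\<close> to \<open>y\<close> (\<open>visit_kernel\<close>, \<open>occupation_moments\<close>).

  The time integrals have a closed form.  Let \<open>p\<^sub>t\<close> be the heat kernel and let \<open>T\<close> send \<open>g\<close>
  to its tail \<open>r \<mapsto> \<integral>\<^sub>0\<^sup>\<infinity> g(r + v) dv\<close>.  Then, for \<open>r, r' \<ge> 0\<close>,
  \<open>\<integral>\<^sub>0\<^sup>t (T\<^sup>n p\<^sub>s)(r) p\<^sub>t\<^sub>-\<^sub>s(r') ds = (T\<^sup>n\<^sup>+\<^sup>1 p\<^sub>t)(r + r')\<close>
  (\<open>convolution_heat_tail\<close>): every visit adds its distance to the argument and one tail.  So the
  time integrals give \<open>T\<^sup>n p\<^sub>t\<close> at the length \<open>\<bar>x\<^sub>1\<bar> + \<bar>x\<^sub>2 - x\<^sub>1\<bar> + \<dots> + \<bar>y - x\<^sub>n\<bar>\<close> of the way, and if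
  \<open>n \<ge> 1\<close> and all \<open>x\<^sub>i\<close> tend to \<open>a\<close> this tends to \<open>T\<^sup>n p\<^sub>t\<close> at \<open>r = \<bar>a\<bar> + \<bar>y - a\<bar>\<close>.
  For \<open>n = 0\<close> there is no visit, and the value is \<open>p\<^sub>t(y)\<close>.

  The claimed law has the same moments.  Its density in \<open>v\<close> is \<open>d\<^sub>t(r + v)\<close>, where
  \<open>d\<^sub>t(r) = (r / t) p\<^sub>t(r)\<close> is minus the derivative of \<open>p\<^sub>t\<close>, so that \<open>p\<^sub>t = T d\<^sub>t\<close> and
  \<open>\<integral>\<^sub>0\<^sup>\<infinity> (v\<^sup>n / n!) d\<^sub>t(r + v) dv = (T\<^sup>n\<^sup>+\<^sup>1 d\<^sub>t)(r) = (T\<^sup>n p\<^sub>t)(r)\<close>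
  (\<open>heat_tail_moment\<close>).  The atom at \<open>v = 0\<close> has mass \<open>p\<^sub>t(y) - p\<^sub>t(r)\<close>; it affects the
  moment of order \<open>0\<close> alone and turns \<open>p\<^sub>t(r)\<close> into \<open>p\<^sub>t(y)\<close>.

  To conclude from the moments to the law, the characteristic function of \<open>A\<close> on the event that
  \<open>B\<^sub>t\<close> lies in a Borel set is expanded into its moments.  The left side converges as the bump
  shrinks since it is bounded, and the series converges since its terms are dominated by a
  geometric series uniformly in the bump (\<open>char_occupation_tendsto\<close>); this rests on
  \<open>T\<^sup>n p\<^sub>t(r) \<le> C \<beta>\<^sup>-\<^sup>n exp(-\<beta> r)\<close>, which holds for every \<open>\<beta> > 0\<close>.  Levy's uniqueness theorem,
  applied on each such event, identifies the joint law (\<open>joint_distr_eqI_char\<close>).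
\<close>

section \<open>The heat kernel and the first passage density\<close>

definition heat_kernel :: "real \<Rightarrow> real \<Rightarrow> real" where
  "heat_kernel t x = exp (- x\<^sup>2 / (2 * t)) / sqrt (2 * pi * t)"

text \<open>
  The density at time \<open>t\<close> of the first passage of Brownian motion through the level \<open>r > 0\<close>.
  Here it matters as minus the derivative of the heat kernel in space.
\<close>

definition passage_density :: "real \<Rightarrow> real \<Rightarrow> real" where
  "passage_density t r = r / t * heat_kernel t r"

lemma heat_kernel_measurable [measurable]:
  "(\<lambda>(t, x). heat_kernel t x) \<in> borel_measurable (borel \<Otimes>\<^sub>M borel)"
  unfolding heat_kernel_def by measurable

lemma passage_density_measurable [measurable]:
  "(\<lambda>(t, x). passage_density t x) \<in> borel_measurable (borel \<Otimes>\<^sub>M borel)"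
  unfolding passage_density_def by measurable

lemma heat_kernel_nonneg: "0 \<le> t \<Longrightarrow> 0 \<le> heat_kernel t x"
  by (simp add: heat_kernel_def)

lemma passage_density_nonneg: "0 \<le> t \<Longrightarrow> 0 \<le> r \<Longrightarrow> 0 \<le> passage_density t r"
  by (simp add: passage_density_def heat_kernel_nonneg)

lemma normal_density_heat_kernel: "0 < t \<Longrightarrow> normal_density 0 (sqrt t) x = heat_kernel t x"
  by (simp add: normal_density_def heat_kernel_def)

lemma nn_integral_heat_kernel:
  assumes "0 < t"
  shows "(\<integral>\<^sup>+ x. ennreal (heat_kernel t x) \<partial>lborel) = 1"
proof -
  interpret prob_space "density lborel (\<lambda>x. ennreal (normal_density 0 (sqrt t) x))"
    by (rule prob_space_normal_density) (use assms in simp)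
  show ?thesis
    using emeasure_space_1 assms by (simp add: emeasure_density normal_density_heat_kernel)
qed

lemma heat_kernel_antimono: "0 < t \<Longrightarrow> 0 \<le> r \<Longrightarrow> r \<le> r' \<Longrightarrow> heat_kernel t r' \<le> heat_kernel t r"
  by (auto simp: heat_kernel_def intro!: divide_right_mono power_mono)

lemma heat_kernel_abs: "heat_kernel t \<bar>x\<bar> = heat_kernel t x"
  by (simp add: heat_kernel_def)

lemma heat_kernel_minus: "heat_kernel t (- x) = heat_kernel t x"
  by (simp add: heat_kernel_def)

text \<open>
  Completing the square: a Gaussian lies below every exponential, at the cost of a constant that
  depends on the rate.
\<close>

lemma heat_kernel_exp_bound:
  assumes "t > 0"
  shows "heat_kernel t r \<le> exp (\<beta>\<^sup>2 * t / 2) / sqrt (2 * pi * t) * exp (- \<beta> * r)"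
proof -
  have "(r - \<beta> * t)\<^sup>2 / (2 * t) \<ge> 0" using assms by simp
  also have "(r - \<beta> * t)\<^sup>2 / (2 * t) = r\<^sup>2 / (2 * t) - \<beta> * r + \<beta>\<^sup>2 * t / 2"
    using assms by (simp add: field_simps power2_eq_square)
  finally have "exp (- r\<^sup>2 / (2 * t)) \<le> exp (\<beta>\<^sup>2 * t / 2) * exp (- \<beta> * r)"
    by (simp add: exp_add[symmetric])
  then show ?thesis unfolding heat_kernel_def using assms by (simp add: divide_right_mono)
qed

lemma nn_integral_passage_density:
  assumes "t > 0" "r \<ge> 0"
  shows "(\<integral>\<^sup>+ v. ennreal (passage_density t (r + v)) * indicator {0..} v \<partial>lborel) = ennreal (heat_kernel t r)"
proof -
  have "(\<integral>\<^sup>+ v. ennreal (passage_density t (r + v)) * indicator {0..} v \<partial>lborel) 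
      = ennreal (0 - (- heat_kernel t (r + 0)))"
  proof (rule nn_integral_FTC_atLeast)
    show "((\<lambda>v. - heat_kernel t (r + v)) \<longlongrightarrow> 0) at_top"
      unfolding heat_kernel_def using assms(1) by real_asymp
    fix x :: real
    show "((\<lambda>v. - heat_kernel t (r + v)) has_real_derivative passage_density t (r + x)) (at x)"
    proof -
      define c where "c = sqrt (2 * pi * t)"
      have "c > 0" using assms by (simp add: c_def)
      then show ?thesis
        unfolding heat_kernel_def passage_density_def c_def[symmetric] using assms
        by (auto intro!: derivative_eq_intros simp: field_simps)
    qed
  qed (use assms in \<open>auto intro!: passage_density_nonneg\<close>)
  then show ?thesis by simp
qed

section \<open>The convolution of heat kernels in time\<close>

lemma interval_integral_has_derivative:
  fixes f :: "real \<Rightarrow> real"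
  assumes "continuous_on UNIV f"
  shows "((\<lambda>x. LBINT u=0..x. f u) has_real_derivative f x) (at x)"
proof -
  define l u where "l = min 0 x - 1" and "u = max 0 x + 1"
  have "((\<lambda>u. LBINT y=ereal 0..ereal u. f y) has_vector_derivative f x) (at x within {l..u})"
    by (rule interval_integral_FTC2)
       (auto simp: l_def u_def intro!: continuous_on_subset[OF assms])
  moreover have "at x within {l..u} = at x"
    by (rule at_within_interior) (auto simp: l_def u_def)
  ultimately show ?thesis
    by (simp add: has_real_derivative_iff_has_vector_derivative zero_ereal_def)
qed

text \<open>
  The error function up to a factor.
\<close>

definition gauss_primitive :: "real \<Rightarrow> real" where
  "gauss_primitive x = (LBINT u=0..x. exp (- u\<^sup>2))"

lemma gauss_primitive_deriv: "(gauss_primitive has_real_derivative exp (- x\<^sup>2)) (at x)"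
  unfolding gauss_primitive_def[abs_def]
  by (rule interval_integral_has_derivative) (intro continuous_intros)

lemma gauss_primitive_0: "gauss_primitive 0 = 0"
  by (simp add: gauss_primitive_def zero_ereal_def)

lemma gauss_primitive_minus: "gauss_primitive (- x) = - gauss_primitive x"
proof -
  have "((\<lambda>x. gauss_primitive (- x) + gauss_primitive x) has_real_derivative 0) (at x)" for x
    by (auto intro!: derivative_eq_intros DERIV_chain2[OF gauss_primitive_deriv] gauss_primitive_deriv)
  then have "gauss_primitive (- x) + gauss_primitive x = gauss_primitive (- 0) + gauss_primitive 0"
    using DERIV_isconst_all by metis
  then show ?thesis by (simp add: gauss_primitive_0)
qed

lemma gauss_primitive_at_top: "(gauss_primitive \<longlongrightarrow> sqrt pi / 2) at_top"
proof -
  let ?f = "\<lambda>x::real. indicator {0..} x *\<^sub>R exp (- x\<^sup>2)"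
  have "((\<lambda>y. \<integral>x. indicator {..y} x *\<^sub>R ?f x \<partial>lborel) \<longlongrightarrow> integral\<^sup>L lborel ?f) at_top"
    using gaussian_moment_0 by (intro tendsto_integral_at_top) (auto simp: has_bochner_integral_iff)
  also have "integral\<^sup>L lborel ?f = sqrt pi / 2"
    using gaussian_moment_0 by (simp add: has_bochner_integral_iff)
  finally have *: "((\<lambda>y. \<integral>x. indicator {..y} x *\<^sub>R ?f x \<partial>lborel) \<longlongrightarrow> sqrt pi / 2) at_top" .
  have "eventually (\<lambda>y. (\<integral>x. indicator {..y} x *\<^sub>R ?f x \<partial>lborel) = gauss_primitive y) at_top"
    using eventually_ge_at_top[of "0::real"]
  proof eventually_elim
    case (elim y)
    then show ?case
      unfolding gauss_primitive_def zero_ereal_def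
      by (subst interval_integral_Icc) 
         (auto simp: set_lebesgue_integral_def indicator_def intro!: Bochner_Integration.integral_cong)
  qed
  from Lim_transform_eventually[OF * this] show ?thesis .
qed

lemma gauss_primitive_at_bot: "(gauss_primitive \<longlongrightarrow> - (sqrt pi / 2)) at_bot"
  using tendsto_minus[OF gauss_primitive_at_top]
  by (simp add: filterlim_at_bot_mirror gauss_primitive_minus)

text \<open>
  The integrand of the convolution of a heat kernel and a passage density has an elementary
  primitive in \<open>s\<close>.  In the variable \<open>u = sqrt (s / (t - s))\<close>, completing the square gives
  \<open>r\<^sup>2 / (2 s) + r'\<^sup>2 / (2 (t - s)) = (r + r')\<^sup>2 / (2 t) + (r' u - r / u)\<^sup>2 / (2 t)\<close>,
  and a weighted sum of two error functions, in \<open>r' u - r / u\<close> and in \<open>r' u + r / u\<close>, differentiates to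
  a Gaussian in \<open>r' u - r / u\<close>: the squares of the two arguments differ by the constant
  \<open>4 r r'\<close>, and the terms \<open>r / u\<^sup>2\<close> of the inner derivatives cancel.
\<close>

lemma convolution_antiderivative:
  fixes r r' t s :: real
  assumes "0 < s" "s < t"
  defines "\<alpha> \<equiv> \<lambda>s. (r' * (sqrt s / sqrt (t - s)) - r * (sqrt (t - s) / sqrt s)) / sqrt (2 * t)"
  defines "\<beta> \<equiv> \<lambda>s. (r' * (sqrt s / sqrt (t - s)) + r * (sqrt (t - s) / sqrt s)) / sqrt (2 * t)"
  shows "((\<lambda>s. heat_kernel t (r + r') / sqrt pi * 
      (gauss_primitive (\<alpha> s) + exp (2 * r * r' / t) * gauss_primitive (\<beta> s)))
     has_real_derivative heat_kernel s r * passage_density (t - s) r') (at s)"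
proof -
  \<comment> \<open>In terms of the square roots of \<open>s\<close>, \<open>t - s\<close> and \<open>2 * t\<close>, the identities below are rational.\<close>
  define \<rho> \<sigma> \<kappa> where "\<rho> = sqrt s" and "\<sigma> = sqrt (t - s)" and "\<kappa> = sqrt (2 * t)"
  have pos: "\<rho> > 0" "\<sigma> > 0" "\<kappa> > 0" using assms by (auto simp: \<rho>_def \<sigma>_def \<kappa>_def)
  have s: "s = \<rho>\<^sup>2" and ts: "t - s = \<sigma>\<^sup>2" and t2: "2 * t = \<kappa>\<^sup>2"
    using assms by (auto simp: \<rho>_def \<sigma>_def \<kappa>_def)
  have t: "t = \<rho>\<^sup>2 + \<sigma>\<^sup>2" using s ts by simp
  have dr: "(sqrt has_real_derivative 1 / (2 * \<rho>)) (at s)"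
    using DERIV_real_sqrt[OF assms(1)] by (simp add: \<rho>_def field_simps)
  have ds: "((\<lambda>s. sqrt (t - s)) has_real_derivative - 1 / (2 * \<sigma>)) (at s)"
    using assms by (auto intro!: derivative_eq_intros simp: \<sigma>_def field_simps)
  have d1: "((\<lambda>s. sqrt s / sqrt (t - s)) has_real_derivative t / (2 * \<rho> * \<sigma> ^ 3)) (at s)"
  proof -
    have "((\<lambda>s. sqrt s / sqrt (t - s)) has_real_derivative (1 / (2 * \<rho>) * \<sigma> - \<rho> * (- 1 / (2 * \<sigma>))) / (\<sigma> * \<sigma>)) (at s)"
      using DERIV_divide[OF dr ds] pos by (simp add: \<rho>_def \<sigma>_def)
    also have "(1 / (2 * \<rho>) * \<sigma> - \<rho> * (- 1 / (2 * \<sigma>))) / (\<sigma> * \<sigma>) = t / (2 * \<rho> * \<sigma> ^ 3)"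
      using pos unfolding t by (simp add: field_simps power2_eq_square power3_eq_cube)
    finally show ?thesis .
  qed
  have d2: "((\<lambda>s. sqrt (t - s) / sqrt s) has_real_derivative - t / (2 * \<rho> ^ 3 * \<sigma>)) (at s)"
  proof -
    have "((\<lambda>s. sqrt (t - s) / sqrt s) has_real_derivative (- 1 / (2 * \<sigma>) * \<rho> - \<sigma> * (1 / (2 * \<rho>))) / (\<rho> * \<rho>)) (at s)"
      using DERIV_divide[OF ds dr] pos by (simp add: \<rho>_def \<sigma>_def)
    also have "(- 1 / (2 * \<sigma>) * \<rho> - \<sigma> * (1 / (2 * \<rho>))) / (\<rho> * \<rho>) = - t / (2 * \<rho> ^ 3 * \<sigma>)"
      using pos unfolding t by (simp add: field_simps power2_eq_square power3_eq_cube)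
    finally show ?thesis .
  qed
  define A where "A = (r' * (t / (2 * \<rho> * \<sigma> ^ 3)) + r * (t / (2 * \<rho> ^ 3 * \<sigma>))) / \<kappa>"
  define C where "C = (r' * (t / (2 * \<rho> * \<sigma> ^ 3)) - r * (t / (2 * \<rho> ^ 3 * \<sigma>))) / \<kappa>"
  have dA: "(\<alpha> has_real_derivative A) (at s)"
    unfolding \<alpha>_def A_def \<kappa>_def[symmetric]
    using DERIV_cdivide[OF DERIV_diff[OF DERIV_cmult[OF d1, of r'] DERIV_cmult[OF d2, of r]], of \<kappa>] by simp
  have dC: "(\<beta> has_real_derivative C) (at s)"
    unfolding \<beta>_def C_def \<kappa>_def[symmetric]
    using DERIV_cdivide[OF DERIV_add[OF DERIV_cmult[OF d1, of r'] DERIV_cmult[OF d2, of r]], of \<kappa>] by simp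
  have al: "\<alpha> s = (r' * (\<rho> / \<sigma>) - r * (\<sigma> / \<rho>)) / \<kappa>" and be: "\<beta> s = (r' * (\<rho> / \<sigma>) + r * (\<sigma> / \<rho>)) / \<kappa>"
    by (simp_all add: \<alpha>_def \<beta>_def \<rho>_def \<sigma>_def \<kappa>_def)
  have k2: "\<kappa>\<^sup>2 = 2 * (\<rho>\<^sup>2 + \<sigma>\<^sup>2)" using t2 t by simp
  have "(\<beta> s)\<^sup>2 - (\<alpha> s)\<^sup>2 = 4 * r * r' / \<kappa>\<^sup>2"
    unfolding al be using pos by (simp add: field_simps power2_eq_square)
  then have exp1: "exp (2 * r * r' / t) * exp (- (\<beta> s)\<^sup>2) = exp (- (\<alpha> s)\<^sup>2)"
    using t2[symmetric] by (simp add: exp_add[symmetric] algebra_simps)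
  have "(r + r')\<^sup>2 / \<kappa>\<^sup>2 + (\<alpha> s)\<^sup>2 = r\<^sup>2 / (2 * \<rho>\<^sup>2) + r'\<^sup>2 / (2 * \<sigma>\<^sup>2)"
  proof -
    have "(r + r')\<^sup>2 / \<kappa>\<^sup>2 + (\<alpha> s)\<^sup>2 = ((r + r')\<^sup>2 + (r' * (\<rho> / \<sigma>) - r * (\<sigma> / \<rho>))\<^sup>2) / \<kappa>\<^sup>2"
      unfolding al by (simp add: power_divide add_divide_distrib)
    also have "(r + r')\<^sup>2 + (r' * (\<rho> / \<sigma>) - r * (\<sigma> / \<rho>))\<^sup>2 = (\<rho>\<^sup>2 + \<sigma>\<^sup>2) * (r\<^sup>2 / \<rho>\<^sup>2 + r'\<^sup>2 / \<sigma>\<^sup>2)"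
      using pos by (simp add: field_simps power2_eq_square)
    also have "\<dots> / \<kappa>\<^sup>2 = (r\<^sup>2 / \<rho>\<^sup>2 + r'\<^sup>2 / \<sigma>\<^sup>2) / 2"
    proof -
      have "c * x / (2 * c) = x / 2" if "c > 0" for c x :: real using that by simp
      from this[of "\<rho>\<^sup>2 + \<sigma>\<^sup>2"] show ?thesis unfolding k2 using pos by (simp only: add_pos_pos zero_less_power)
    qed
    also have "\<dots> = r\<^sup>2 / (2 * \<rho>\<^sup>2) + r'\<^sup>2 / (2 * \<sigma>\<^sup>2)"
      by (simp add: add_divide_distrib mult.commute)
    finally show ?thesis .
  qed
  then have "- (r + r')\<^sup>2 / \<kappa>\<^sup>2 + - (\<alpha> s)\<^sup>2 = - r\<^sup>2 / (2 * \<rho>\<^sup>2) + - r'\<^sup>2 / (2 * \<sigma>\<^sup>2)"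
    by simp
  then have exp2: "exp (- (r + r')\<^sup>2 / \<kappa>\<^sup>2) * exp (- (\<alpha> s)\<^sup>2) = exp (- r\<^sup>2 / (2 * \<rho>\<^sup>2)) * exp (- r'\<^sup>2 / (2 * \<sigma>\<^sup>2))"
    by (simp only: exp_add[symmetric])
  have AC: "A + C = r' * t / (\<rho> * \<sigma> ^ 3 * \<kappa>)"
    unfolding A_def C_def using pos by (simp add: field_simps)
  have hk: "heat_kernel t (r + r') = exp (- (r + r')\<^sup>2 / \<kappa>\<^sup>2) / (sqrt pi * \<kappa>)"
    unfolding heat_kernel_def t2 by (simp add: real_sqrt_mult \<kappa>_def)
  have hk1: "heat_kernel s r = exp (- r\<^sup>2 / (2 * \<rho>\<^sup>2)) / (sqrt (2 * pi) * \<rho>)"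
    unfolding heat_kernel_def s using pos by (simp add: real_sqrt_mult)
  have hk2: "passage_density (t - s) r' = r' / \<sigma>\<^sup>2 * (exp (- r'\<^sup>2 / (2 * \<sigma>\<^sup>2)) / (sqrt (2 * pi) * \<sigma>))"
    unfolding passage_density_def heat_kernel_def ts using pos by (simp add: real_sqrt_mult)
  have tk: "t / (\<kappa> * \<kappa>) = 1 / 2"
    unfolding power2_eq_square[symmetric] t2[symmetric] using assms by simp
  have "heat_kernel t (r + r') / sqrt pi * (exp (- (\<alpha> s)\<^sup>2) * A + exp (2 * r * r' / t) * (exp (- (\<beta> s)\<^sup>2) * C))
      = heat_kernel t (r + r') / sqrt pi * (exp (- (\<alpha> s)\<^sup>2) * (A + C))"
    unfolding exp1[symmetric] by (simp only: distrib_left mult.assoc)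
  also have "\<dots> = (exp (- (r + r')\<^sup>2 / \<kappa>\<^sup>2) * exp (- (\<alpha> s)\<^sup>2)) * (r' * t / (\<rho> * \<sigma> ^ 3 * \<kappa>)) / (sqrt pi * sqrt pi * \<kappa>)"
  proof -
    have "x / (a * k) / a * (y * z) = x * y * z / (a * a * k)" for x a k y z :: real
      by (simp add: field_simps)
    then show ?thesis unfolding AC hk by blast
  qed
  also have "\<dots> = exp (- r\<^sup>2 / (2 * \<rho>\<^sup>2)) * exp (- r'\<^sup>2 / (2 * \<sigma>\<^sup>2)) * (r' / (\<rho> * \<sigma> ^ 3)) * (t / (\<kappa> * \<kappa>)) / pi"
    unfolding exp2 by (simp add: mult_ac)
  also have "\<dots> = heat_kernel s r * passage_density (t - s) r'"
  proof -
    have "x * y * (r' / (\<rho> * \<sigma> ^ 3)) * (1 / 2) / pi = x / (q * \<rho>) * (r' / \<sigma>\<^sup>2 * (y / (q * \<sigma>)))" 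
      if "q * q = 2 * pi" for x y q
    proof -
      have "x / (q * \<rho>) * (r' / \<sigma>\<^sup>2 * (y / (q * \<sigma>))) = x * y * (r' / (\<rho> * \<sigma> ^ 3)) / (q * q)"
        by (simp add: power2_eq_square power3_eq_cube mult_ac)
      then show ?thesis unfolding that by simp
    qed
    then show ?thesis unfolding hk1 hk2 tk by simp
  qed
  finally have eq: "heat_kernel t (r + r') / sqrt pi * (exp (- (\<alpha> s)\<^sup>2) * A + exp (2 * r * r' / t) * (exp (- (\<beta> s)\<^sup>2) * C))
      = heat_kernel s r * passage_density (t - s) r'" .
  show ?thesis
    unfolding eq[symmetric]
    by (intro DERIV_cmult DERIV_add DERIV_chain2[OF gauss_primitive_deriv] dA dC)
qed

text \<open>
  Probabilistically: a path from \<open>0\<close> to \<open>r + r'\<close> passes through \<open>r'\<close> for the first time at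
  some time \<open>t - s\<close> and moves by \<open>r\<close> in the remaining time \<open>s\<close>.  The proof evaluates the
  primitive of \<open>convolution_antiderivative\<close> at both ends of the interval.
\<close>

lemma convolution_heat_passage:
  assumes t: "t > 0" and r: "r \<ge> 0" and r': "r' > 0"
  shows "(\<integral>\<^sup>+ s. indicator {0<..<t} s * ennreal (heat_kernel s r * passage_density (t - s) r') \<partial>lborel)
    = ennreal (heat_kernel t (r + r'))"
proof -
  let ?f = "\<lambda>s. heat_kernel s r * passage_density (t - s) r'"
  define \<alpha> where "\<alpha> = (\<lambda>s. (r' * (sqrt s / sqrt (t - s)) - r * (sqrt (t - s) / sqrt s)) / sqrt (2 * t))"
  define \<beta> where "\<beta> = (\<lambda>s. (r' * (sqrt s / sqrt (t - s)) + r * (sqrt (t - s) / sqrt s)) / sqrt (2 * t))"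
  define G where "G = (\<lambda>s. heat_kernel t (r + r') / sqrt pi * 
      (gauss_primitive (\<alpha> s) + exp (2 * r * r' / t) * gauss_primitive (\<beta> s)))"
  define g where "g = heat_kernel t (r + r') / sqrt pi"
  define e where "e = exp (2 * r * r' / t)"
  have lim_t: "(G \<longlongrightarrow> g * (sqrt pi / 2 + e * (sqrt pi / 2))) (at_left t)"
  proof -
    have "filterlim \<alpha> at_top (at_left t)" unfolding \<alpha>_def using t r' by real_asymp
    moreover have "filterlim \<beta> at_top (at_left t)" unfolding \<beta>_def using t r' by real_asymp
    ultimately show ?thesis unfolding G_def g_def[symmetric] e_def[symmetric]
      by (intro tendsto_intros filterlim_compose[OF gauss_primitive_at_top])
  qed
  have lim_0: "(G \<longlongrightarrow> g * (e * (sqrt pi / 2) - sqrt pi / 2)) (at_right 0)"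
  \<comment> \<open>At the left end the arguments of the error functions tend to \<open>-\<infinity>\<close> and \<open>\<infinity>\<close>, except for
    \<open>r = 0\<close>, where both tend to \<open>0\<close>; the limit of the primitive is the same.\<close>
  proof (cases "r = 0")
    case True
    have "(\<alpha> \<longlongrightarrow> 0) (at_right 0)" "(\<beta> \<longlongrightarrow> 0) (at_right 0)" 
      unfolding \<alpha>_def \<beta>_def True using t r' by real_asymp+
    moreover have "isCont gauss_primitive 0" using gauss_primitive_deriv DERIV_isCont by blast
    ultimately have "((\<lambda>s. gauss_primitive (\<alpha> s)) \<longlongrightarrow> 0) (at_right 0)" "((\<lambda>s. gauss_primitive (\<beta> s)) \<longlongrightarrow> 0) (at_right 0)"
      using isCont_tendsto_compose gauss_primitive_0 by metis+
    then have "(G \<longlongrightarrow> g * (0 + e * 0)) (at_right 0)"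
      unfolding G_def g_def[symmetric] e_def[symmetric] by (intro tendsto_intros)
    then show ?thesis by (simp add: True e_def)
  next
    case False
    then have r0: "r > 0" using r by simp
    have "filterlim \<alpha> at_bot (at_right 0)" unfolding \<alpha>_def using t r' r0 by real_asymp
    moreover have "filterlim \<beta> at_top (at_right 0)" unfolding \<beta>_def using t r' r0 by real_asymp
    ultimately have "(G \<longlongrightarrow> g * (- (sqrt pi / 2) + e * (sqrt pi / 2))) (at_right 0)" 
      unfolding G_def g_def[symmetric] e_def[symmetric]
      by (intro tendsto_intros filterlim_compose[OF gauss_primitive_at_top] filterlim_compose[OF gauss_primitive_at_bot])
    then show ?thesis by simp
  qed
  have nonneg: "0 \<le> ?f s" if "0 < s" "s < t" for s
    using that r' by (intro mult_nonneg_nonneg heat_kernel_nonneg passage_density_nonneg) auto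
  have cont: "isCont ?f s" if "0 < s" "s < t" for s
    using that unfolding heat_kernel_def passage_density_def
    by (intro continuous_intros) auto
  have G': "DERIV G s :> ?f s" if "0 < s" "s < t" for s
    unfolding G_def \<alpha>_def \<beta>_def using that by (rule convolution_antiderivative)
  have FTC: "set_integrable lborel (einterval (ereal 0) (ereal t)) ?f"
    "(LBINT s=ereal 0..ereal t. ?f s) = g * (sqrt pi / 2 + e * (sqrt pi / 2)) - g * (e * (sqrt pi / 2) - sqrt pi / 2)"
    by (rule interval_integral_FTC_nonneg[where F=G and A="g * (e * (sqrt pi / 2) - sqrt pi / 2)"]; 
        use t lim_0 lim_t G' cont nonneg in \<open>simp add: ereal_tendsto_simps\<close>)+
  have "(\<integral>\<^sup>+ s. indicator {0<..<t} s * ennreal (?f s) \<partial>lborel) = (\<integral>\<^sup>+ s. ennreal (indicator {0<..<t} s *\<^sub>R ?f s) \<partial>lborel)"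
    by (intro nn_integral_cong) (simp add: indicator_def)
  also have "\<dots> = ennreal (LINT s|lborel. indicator {0<..<t} s *\<^sub>R ?f s)"
    using FTC(1) nonneg by (intro nn_integral_eq_integral) (auto simp: set_integrable_def indicator_def)
  also have "(LINT s|lborel. indicator {0<..<t} s *\<^sub>R ?f s) = (LBINT s=ereal 0..ereal t. ?f s)"
    using t by (simp add: interval_lebesgue_integral_def set_lebesgue_integral_def)
  also have "\<dots> = heat_kernel t (r + r')"
    unfolding FTC(2) g_def by (simp add: field_simps)
  finally show ?thesis .
qed

text \<open>
  A heat kernel is the tail of the passage density, so that this is the tail in \<open>r'\<close> of
  \<open>convolution_heat_passage\<close>.
\<close>

lemma convolution_heat_heat:
  assumes t: "t > 0" and r: "r \<ge> 0" and r': "r' \<ge> 0"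
  shows "(\<integral>\<^sup>+ s. indicator {0<..<t} s * ennreal (heat_kernel s r * heat_kernel (t - s) r') \<partial>lborel)
    = (\<integral>\<^sup>+ v. ennreal (heat_kernel t (r + r' + v)) * indicator {0..} v \<partial>lborel)"
proof -
  let ?I = "\<lambda>s::real. indicator {0<..<t} s :: ennreal" and ?J = "\<lambda>v::real. indicator {0..} v :: ennreal"
  have "(\<integral>\<^sup>+ s. ?I s * ennreal (heat_kernel s r * heat_kernel (t - s) r') \<partial>lborel) =
     (\<integral>\<^sup>+ s. (\<integral>\<^sup>+ v. ?I s * (ennreal (heat_kernel s r * passage_density (t - s) (r' + v)) * ?J v) \<partial>lborel) \<partial>lborel)"
  proof (intro nn_integral_cong)
    fix s :: real
    show "?I s * ennreal (heat_kernel s r * heat_kernel (t - s) r') = 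
      (\<integral>\<^sup>+ v. ?I s * (ennreal (heat_kernel s r * passage_density (t - s) (r' + v)) * ?J v) \<partial>lborel)"
    proof (cases "0 < s \<and> s < t")
      case True
      then have "ennreal (heat_kernel s r * heat_kernel (t - s) r') = 
          ennreal (heat_kernel s r) * (\<integral>\<^sup>+ v. ennreal (passage_density (t - s) (r' + v)) * ?J v \<partial>lborel)"
        using r' by (subst nn_integral_passage_density) (auto simp: ennreal_mult' heat_kernel_nonneg)
      also have "\<dots> = (\<integral>\<^sup>+ v. ennreal (heat_kernel s r) * (ennreal (passage_density (t - s) (r' + v)) * ?J v) \<partial>lborel)"
        by (rule nn_integral_cmult[symmetric]) simp
      finally show ?thesis using True r' 
        by (simp add: ennreal_mult' heat_kernel_nonneg mult.assoc)
    qed (auto simp: indicator_def)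
  qed
  also have "\<dots> = (\<integral>\<^sup>+ v. (\<integral>\<^sup>+ s. ?I s * (ennreal (heat_kernel s r * passage_density (t - s) (r' + v)) * ?J v) \<partial>lborel) \<partial>lborel)"
    by (rule lborel_pair.Fubini') simp
  also have "\<dots> = (\<integral>\<^sup>+ v. ennreal (heat_kernel t (r + r' + v)) * ?J v \<partial>lborel)"
  \<comment> \<open>The formula for the passage density needs a positive second argument, hence \<open>v \<noteq> 0\<close>.\<close>
  proof (rule nn_integral_cong_AE, rule AE_mp[OF AE_lborel_singleton[of 0]], rule AE_I2, rule impI)
    fix v :: real assume "v \<noteq> 0"
    show "(\<integral>\<^sup>+ s. ?I s * (ennreal (heat_kernel s r * passage_density (t - s) (r' + v)) * ?J v) \<partial>lborel)
      = ennreal (heat_kernel t (r + r' + v)) * ?J v"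
    proof (cases "v \<ge> 0")
      case True
      with \<open>v \<noteq> 0\<close> r' have "r' + v > 0" by simp
      from convolution_heat_passage[OF t r this] True show ?thesis
        by (simp add: add.assoc)
    qed simp
  qed
  finally show ?thesis .
qed

section \<open>Iterated tails of the heat kernel\<close>

primrec heat_tail :: "nat \<Rightarrow> real \<Rightarrow> real \<Rightarrow> ennreal" where
  "heat_tail 0 t r = ennreal (heat_kernel t r)"
| "heat_tail (Suc n) t r = (\<integral>\<^sup>+ v. heat_tail n t (r + v) * indicator {0..} v \<partial>lborel)"

lemma heat_tail_measurable [measurable]:
  "(\<lambda>(t, r). heat_tail n t r) \<in> borel_measurable (borel \<Otimes>\<^sub>M borel)"
proof (induction n)
  case (Suc n)
  note [measurable] = Suc
  have "(\<lambda>p. heat_tail n (fst (fst p)) (snd (fst p) + snd p)) \<in> borel_measurable ((borel \<Otimes>\<^sub>M borel) \<Otimes>\<^sub>M lborel)"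
    using measurable_compose[where f="\<lambda>p::((real \<times> real) \<times> real). (fst (fst p), snd (fst p) + snd p)", OF _ Suc]
    by (simp add: split_beta)
  then have "(\<lambda>x. \<integral>\<^sup>+ v. heat_tail n (fst x) (snd x + v) * indicator {0..} v \<partial>lborel)
      \<in> borel_measurable (borel \<Otimes>\<^sub>M borel)"
    by (intro lborel.borel_measurable_nn_integral) (simp add: split_beta)
  then show ?case by (simp add: split_beta)
qed (simp add: split_beta)

lemma measurable_heat_tail [measurable (raw)]:
  assumes "f \<in> borel_measurable N" "g \<in> borel_measurable N"
  shows "(\<lambda>x. heat_tail n (f x) (g x)) \<in> borel_measurable N"
proof -
  have "(\<lambda>x. (f x, g x)) \<in> N \<rightarrow>\<^sub>M borel \<Otimes>\<^sub>M borel" using assms by simp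
  from measurable_compose[OF this heat_tail_measurable] show ?thesis by simp
qed

lemma heat_tail_antimono:
  assumes "0 < t" "0 \<le> r" "r \<le> r'"
  shows "heat_tail n t r' \<le> heat_tail n t r"
  using assms(2,3)
proof (induction n arbitrary: r r')
  case (Suc n)
  show ?case
    unfolding heat_tail.simps
    by (intro nn_integral_mono) (use Suc in \<open>auto simp: indicator_def\<close>)
qed (use assms(1) in \<open>auto intro!: ennreal_leI heat_kernel_antimono\<close>)

text \<open>
  Convolution with a heat kernel in time commutes with taking tails in space, so that the case
  \<open>n = 0\<close> is lifted by one tail at a time.
\<close>

lemma convolution_heat_tail:
  assumes t: "t > 0" and r': "r' \<ge> 0"
  shows "r \<ge> 0 \<Longrightarrow> (\<integral>\<^sup>+ s. indicator {0<..<t} s * heat_tail n s r * ennreal (heat_kernel (t - s) r') \<partial>lborel)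
    = heat_tail (Suc n) t (r + r')"
proof (induction n arbitrary: r)
  case 0
  have "(\<integral>\<^sup>+ s. indicator {0<..<t} s * heat_tail 0 s r * ennreal (heat_kernel (t - s) r') \<partial>lborel)
    = (\<integral>\<^sup>+ s. indicator {0<..<t} s * ennreal (heat_kernel s r * heat_kernel (t - s) r') \<partial>lborel)"
    by (intro nn_integral_cong) (auto simp: indicator_def ennreal_mult' heat_kernel_nonneg)
  then show ?case using convolution_heat_heat[OF t 0 r'] by simp
next
  case (Suc n)
  let ?I = "\<lambda>s::real. indicator {0<..<t} s :: ennreal" and ?J = "\<lambda>v::real. indicator {0..} v :: ennreal"
  have "(\<integral>\<^sup>+ s. ?I s * heat_tail (Suc n) s r * ennreal (heat_kernel (t - s) r') \<partial>lborel) =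
      (\<integral>\<^sup>+ s. (\<integral>\<^sup>+ v. ?I s * heat_tail n s (r + v) * ennreal (heat_kernel (t - s) r') * ?J v \<partial>lborel) \<partial>lborel)"
    unfolding heat_tail.simps
    by (subst nn_integral_cmult[symmetric] nn_integral_multc[symmetric], measurable)+ (simp add: mult_ac)
  also have "\<dots> = (\<integral>\<^sup>+ v. (\<integral>\<^sup>+ s. ?I s * heat_tail n s (r + v) * ennreal (heat_kernel (t - s) r') * ?J v \<partial>lborel) \<partial>lborel)"
    by (rule lborel_pair.Fubini') simp
  also have "\<dots> = (\<integral>\<^sup>+ v. heat_tail (Suc n) t (r + v + r') * ?J v \<partial>lborel)"
  proof (rule nn_integral_cong)
    fix v :: real
    show "(\<integral>\<^sup>+ s. ?I s * heat_tail n s (r + v) * ennreal (heat_kernel (t - s) r') * ?J v \<partial>lborel)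
       = heat_tail (Suc n) t (r + v + r') * ?J v"
    proof (cases "v \<ge> 0")
      case True
      then show ?thesis using Suc.IH[of "r + v"] Suc.prems by simp
    qed simp
  qed
  also have "\<dots> = heat_tail (Suc (Suc n)) t (r + r')"
    by (subst (2) heat_tail.simps) (simp add: algebra_simps del: heat_tail.simps)
  finally show ?case .
qed

lemma nn_integral_exp_tail:
  fixes \<beta> r :: real
  assumes "\<beta> > 0"
  shows "(\<integral>\<^sup>+ v. ennreal (exp (- \<beta> * (r + v))) * indicator {0..} v \<partial>lborel) = ennreal (exp (- \<beta> * r) / \<beta>)"
proof -
  have "(\<integral>\<^sup>+ v. ennreal (exp (- \<beta> * (r + v))) * indicator {0..} v \<partial>lborel)
      = ennreal (0 - (- exp (- \<beta> * (r + 0)) / \<beta>))"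
  proof (rule nn_integral_FTC_atLeast)
    show "((\<lambda>v. - exp (- \<beta> * (r + v)) / \<beta>) \<longlongrightarrow> 0) at_top" using assms by real_asymp
    show "((\<lambda>v. - exp (- \<beta> * (r + v)) / \<beta>) has_real_derivative exp (- \<beta> * (r + x))) (at x)" for x
      using assms by (auto intro!: derivative_eq_intros)
  qed auto
  then show ?thesis by simp
qed

lemma heat_tail_exp_bound:
  assumes "t > 0" "\<beta> > 0"
  shows "heat_tail n t r \<le> ennreal (exp (\<beta>\<^sup>2 * t / 2) / sqrt (2 * pi * t) / \<beta> ^ n * exp (- \<beta> * r))"
proof (induction n arbitrary: r)
  case 0
  show ?case using heat_kernel_exp_bound[OF assms(1), of r \<beta>] by (simp add: ennreal_leI)
next
  case (Suc n)
  define C where "C = exp (\<beta>\<^sup>2 * t / 2) / sqrt (2 * pi * t) / \<beta> ^ n"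
  have C: "C \<ge> 0" using assms by (simp add: C_def)
  have "heat_tail (Suc n) t r \<le> (\<integral>\<^sup>+ v. ennreal C * (ennreal (exp (- \<beta> * (r + v))) * indicator {0..} v) \<partial>lborel)"
    unfolding heat_tail.simps
  proof (intro nn_integral_mono)
    fix v :: real
    have "heat_tail n t (r + v) \<le> ennreal C * ennreal (exp (- \<beta> * (r + v)))"
      using Suc[of "r + v"] C by (simp only: C_def[symmetric] ennreal_mult')
    then show "heat_tail n t (r + v) * indicator {0..} v \<le> ennreal C * (ennreal (exp (- \<beta> * (r + v))) * indicator {0..} v)"
      by (simp only: mult.assoc[symmetric] mult_right_mono zero_le)
  qed
  also have "\<dots> = ennreal C * ennreal (exp (- \<beta> * r) / \<beta>)"
    using nn_integral_exp_tail[OF assms(2), of r] by (subst nn_integral_cmult) auto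
  also have "\<dots> = ennreal (C / \<beta> * exp (- \<beta> * r))"
    using C by (simp add: ennreal_mult'[symmetric])
  finally show ?case by (simp add: C_def field_simps)
qed

text \<open>
  The difference of two tails is an integral over an interval of length \<open>\<delta>\<close>, where the integrand
  is at most its value at the left end.
\<close>

lemma heat_tail_modulus:
  assumes "t > 0" "r \<ge> 0" "\<delta> \<ge> 0"
  shows "heat_tail (Suc n) t r \<le> heat_tail (Suc n) t (r + \<delta>) + heat_tail n t r * ennreal \<delta>"
proof -
  have "heat_tail (Suc n) t r = (\<integral>\<^sup>+ v. heat_tail n t (r + v) * indicator {0..} v \<partial>lborel)" by simp
  also have "\<dots> \<le> (\<integral>\<^sup>+ v. heat_tail n t (r + v) * indicator {\<delta>..} v + heat_tail n t r * indicator {0..\<delta>} v \<partial>lborel)"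
    using assms by (intro nn_integral_mono) (auto simp: indicator_def intro!: heat_tail_antimono)
  also have "\<dots> = (\<integral>\<^sup>+ v. heat_tail n t (r + v) * indicator {\<delta>..} v \<partial>lborel) + heat_tail n t r * ennreal \<delta>"
    using assms by (subst nn_integral_add) (auto simp: nn_integral_cmult)
  also have "(\<integral>\<^sup>+ v. heat_tail n t (r + v) * indicator {\<delta>..} v \<partial>lborel) = heat_tail (Suc n) t (r + \<delta>)"
  proof -
    have "(\<integral>\<^sup>+ v. heat_tail n t (r + v) * indicator {\<delta>..} v \<partial>lborel) = 
        (\<integral>\<^sup>+ v. heat_tail n t (r + (\<delta> + 1 * v)) * indicator {\<delta>..} (\<delta> + 1 * v) \<partial>lborel)"
      by (subst nn_integral_real_affine[where c=1 and t=\<delta>]) auto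
    then show ?thesis by (simp add: indicator_def add.assoc)
  qed
  finally show ?thesis .
qed

text \<open>
  Iterating \<open>n + 1\<close> tails is Cauchy's formula for repeated integration, and one of these tails turns
  the passage density into the heat kernel.
\<close>

lemma heat_tail_moment:
  assumes t: "t > 0" 
  shows "r \<ge> 0 \<Longrightarrow> (\<integral>\<^sup>+ v. ennreal (v ^ n / fact n * passage_density t (r + v)) * indicator {0..} v \<partial>lborel) = heat_tail n t r"
proof (induction n arbitrary: r)
  case 0
  then show ?case using nn_integral_passage_density[OF t] by simp
next
  case (Suc n)
  let ?J = "\<lambda>v::real. indicator {0..} v :: ennreal"
  have "heat_tail (Suc n) t r = (\<integral>\<^sup>+ u. (\<integral>\<^sup>+ v. ennreal (v ^ n / fact n * passage_density t (r + u + v)) * ?J v \<partial>lborel) * ?J u \<partial>lborel)"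
    unfolding heat_tail.simps
  proof (intro nn_integral_cong)
    fix u :: real
    show "heat_tail n t (r + u) * ?J u = (\<integral>\<^sup>+ v. ennreal (v ^ n / fact n * passage_density t (r + u + v)) * ?J v \<partial>lborel) * ?J u"
      using Suc.IH[of "r + u"] Suc.prems by (cases "u \<ge> 0") auto
  qed
  also have "\<dots> = (\<integral>\<^sup>+ u. (\<integral>\<^sup>+ w. ennreal ((w - u) ^ n / fact n * passage_density t (r + w)) * ?J (w - u) * ?J u \<partial>lborel) \<partial>lborel)"
  proof (intro nn_integral_cong)
    fix u :: real
    have "(\<integral>\<^sup>+ w. ennreal ((w - u) ^ n / fact n * passage_density t (r + w)) * ?J (w - u) \<partial>lborel)
      = (\<integral>\<^sup>+ v. ennreal (v ^ n / fact n * passage_density t (r + u + v)) * ?J v \<partial>lborel)"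
      by (subst nn_integral_real_affine[where c=1 and t=u]) (auto simp: add.assoc)
    then show "(\<integral>\<^sup>+ v. ennreal (v ^ n / fact n * passage_density t (r + u + v)) * ?J v \<partial>lborel) * ?J u
      = (\<integral>\<^sup>+ w. ennreal ((w - u) ^ n / fact n * passage_density t (r + w)) * ?J (w - u) * ?J u \<partial>lborel)"
      by (simp add: nn_integral_multc)
  qed
  also have "\<dots> = (\<integral>\<^sup>+ w. (\<integral>\<^sup>+ u. ennreal ((w - u) ^ n / fact n * passage_density t (r + w)) * ?J (w - u) * ?J u \<partial>lborel) \<partial>lborel)"
    by (rule lborel_pair.Fubini') simp
  also have "\<dots> = (\<integral>\<^sup>+ w. ennreal (w ^ Suc n / fact (Suc n) * passage_density t (r + w)) * ?J w \<partial>lborel)"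
  proof (intro nn_integral_cong)
    fix w :: real
    show "(\<integral>\<^sup>+ u. ennreal ((w - u) ^ n / fact n * passage_density t (r + w)) * ?J (w - u) * ?J u \<partial>lborel) =
      ennreal (w ^ Suc n / fact (Suc n) * passage_density t (r + w)) * ?J w"
    proof (cases "w \<ge> 0")
      case True
      define d where "d = passage_density t (r + w)"
      have d: "d \<ge> 0" using True Suc.prems t by (auto simp: d_def intro!: passage_density_nonneg)
      have "(\<integral>\<^sup>+ u. ennreal ((w - u) ^ n / fact n * d) * ?J (w - u) * ?J u \<partial>lborel) = 
        (\<integral>\<^sup>+ u. ennreal ((w - u) ^ n / fact n * d) * indicator {0..w} u \<partial>lborel)"
        by (intro nn_integral_cong) (auto simp: indicator_def)
      also have "\<dots> = ennreal (- ((w - w) ^ Suc n / fact (Suc n) * d) - - ((w - 0) ^ Suc n / fact (Suc n) * d))"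
      proof (rule nn_integral_FTC_Icc)
        fix u :: real assume u: "u \<in> {0..w}"
        then show "0 \<le> (w - u) ^ n / fact n * d" using d by simp
        have "DERIV (\<lambda>u. (w - u) ^ Suc n) u :> of_nat (Suc n) * (w - u) ^ n * (- 1)"
          by (auto intro!: derivative_eq_intros simp del: power_Suc)
        from DERIV_cmult_right[OF DERIV_cdivide[OF DERIV_minus[OF this], of "fact (Suc n)"], of d]
        show "DERIV (\<lambda>u. - ((w - u) ^ Suc n / fact (Suc n) * d)) u :> (w - u) ^ n / fact n * d"
          by (simp del: power_Suc of_nat_Suc)
      qed (use True in auto)
      finally show ?thesis using True by (simp add: d_def)
    next
      case False
      then have "(\<integral>\<^sup>+ u. ennreal ((w - u) ^ n / fact n * passage_density t (r + w)) * ?J (w - u) * ?J u \<partial>lborel) = (\<integral>\<^sup>+ u. 0 \<partial>(lborel :: real measure))"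
        by (intro nn_integral_cong) (auto simp: indicator_def)
      then show ?thesis using False by simp
    qed
  qed
  finally show ?case by simp
qed

lemma heat_tail_finite: "0 < t \<Longrightarrow> heat_tail n t r < top"
  by (rule le_less_trans[OF heat_tail_exp_bound[of t 1]]) auto

section \<open>Visits of a bump near the level\<close>

text \<open>
  The density at \<open>y\<close> of the measure \<open>E(A\<^sup>n / n!; B\<^sub>t \<in> dy)\<close>, where \<open>A\<close> is the integral of
  \<open>\<phi>(B\<^sub>s)\<close> over \<open>[0, t]\<close>.  The recursion splits off the last of \<open>n\<close> ordered visits: it takes
  place at time \<open>s\<close> in \<open>x\<close>.
\<close>

primrec visit_kernel :: "(real \<Rightarrow> real) \<Rightarrow> nat \<Rightarrow> real \<Rightarrow> real \<Rightarrow> ennreal" where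
  "visit_kernel \<phi> 0 t y = ennreal (heat_kernel t y)"
| "visit_kernel \<phi> (Suc n) t y = (\<integral>\<^sup>+ s. indicator {0<..<t} s *
     (\<integral>\<^sup>+ x. visit_kernel \<phi> n s x * ennreal (\<phi> x) * ennreal (heat_kernel (t - s) (y - x)) \<partial>lborel) \<partial>lborel)"

lemma visit_kernel_measurable:
  assumes [measurable]: "\<phi> \<in> borel_measurable borel"
  shows "(\<lambda>(t, y). visit_kernel \<phi> n t y) \<in> borel_measurable (borel \<Otimes>\<^sub>M borel)"
proof (induction n)
  case (Suc n)
  have [measurable]: "(\<lambda>p. visit_kernel \<phi> n (snd (fst p)) (snd p)) \<in> borel_measurable (((borel \<Otimes>\<^sub>M borel) \<Otimes>\<^sub>M lborel) \<Otimes>\<^sub>M lborel)"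
  proof -
    have "(\<lambda>p. (snd (fst p), snd p)) \<in> ((borel \<Otimes>\<^sub>M borel) \<Otimes>\<^sub>M lborel) \<Otimes>\<^sub>M lborel \<rightarrow>\<^sub>M borel \<Otimes>\<^sub>M borel"
      by (simp add: borel_prod)
    from measurable_compose[OF this Suc] show ?thesis by (simp add: split_beta)
  qed
  have [measurable]: "Measurable.pred ((borel \<Otimes>\<^sub>M borel) \<Otimes>\<^sub>M lborel) (\<lambda>p::((real \<times> real) \<times> real). snd p \<in> {0<..<fst (fst p)})"
    by simp
  have "(\<lambda>x. \<integral>\<^sup>+ s. indicator {0<..<fst x} s *
     (\<integral>\<^sup>+ z. visit_kernel \<phi> n s z * ennreal (\<phi> z) * ennreal (heat_kernel (fst x - s) (snd x - z)) \<partial>lborel) \<partial>lborel)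
      \<in> borel_measurable (borel \<Otimes>\<^sub>M borel)"
    by (intro lborel.borel_measurable_nn_integral)
       (simp add: split_beta)
  then show ?case by (simp add: split_beta)
qed (simp add: split_beta)

lemma measurable_visit_kernel:
  assumes "\<phi> \<in> borel_measurable borel" "f \<in> borel_measurable N" "g \<in> borel_measurable N"
  shows "(\<lambda>x. visit_kernel \<phi> n (f x) (g x)) \<in> borel_measurable N"
proof -
  have "(\<lambda>x. (f x, g x)) \<in> N \<rightarrow>\<^sub>M borel \<Otimes>\<^sub>M borel" using assms by simp
  from measurable_compose[OF this visit_kernel_measurable[OF assms(1)]] show ?thesis by simp
qed

lemma visit_kernel_Suc:
  assumes [measurable]: "\<phi> \<in> borel_measurable borel"
  shows "visit_kernel \<phi> (Suc n) t y = (\<integral>\<^sup>+ x. ennreal (\<phi> x) *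
    (\<integral>\<^sup>+ s. indicator {0<..<t} s * visit_kernel \<phi> n s x * ennreal (heat_kernel (t - s) \<bar>y - x\<bar>) \<partial>lborel) \<partial>lborel)"
proof -
  note [measurable] = measurable_visit_kernel[OF assms]
  have "visit_kernel \<phi> (Suc n) t y = (\<integral>\<^sup>+ s. (\<integral>\<^sup>+ x. ennreal (\<phi> x) *
    (indicator {0<..<t} s * visit_kernel \<phi> n s x * ennreal (heat_kernel (t - s) \<bar>y - x\<bar>)) \<partial>lborel) \<partial>lborel)"
    unfolding visit_kernel.simps
    by (subst nn_integral_cmult[symmetric], measurable) (simp add: mult_ac heat_kernel_abs)
  also have "\<dots> = (\<integral>\<^sup>+ x. (\<integral>\<^sup>+ s. ennreal (\<phi> x) *
    (indicator {0<..<t} s * visit_kernel \<phi> n s x * ennreal (heat_kernel (t - s) \<bar>y - x\<bar>)) \<partial>lborel) \<partial>lborel)"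
    by (rule lborel_pair.Fubini') simp
  finally show ?thesis by (simp add: nn_integral_cmult)
qed

locale bump =
  fixes \<phi> :: "real \<Rightarrow> real" and a \<epsilon> :: real
  assumes bump_measurable [measurable]: "\<phi> \<in> borel_measurable borel"
    and bump_nonneg: "0 \<le> \<phi> x"
    and bump_mass: "(\<integral>\<^sup>+ x. ennreal (\<phi> x) \<partial>lborel) = 1"
    and bump_support: "\<epsilon> < \<bar>x - a\<bar> \<Longrightarrow> \<phi> x = 0"
    and bump_width: "0 < \<epsilon>"
begin

text \<open>
  A way from \<open>0\<close> to \<open>y\<close> through \<open>n\<close> points of the bump exceeds \<open>\<bar>a\<bar> + \<bar>y - a\<bar>\<close> by at most
  \<open>2 n \<epsilon>\<close>, and the tails decrease in the length of the way.
\<close>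

lemma visit_kernel_lower:
  "0 < t \<Longrightarrow> heat_tail n t (\<bar>a\<bar> + \<bar>y - a\<bar> + 2 * real n * \<epsilon>) \<le> visit_kernel \<phi> n t y"
proof (induction n arbitrary: t y)
  case 0
  then show ?case
    using heat_kernel_antimono[of t "\<bar>y\<bar>" "\<bar>a\<bar> + \<bar>y - a\<bar>"] by (auto simp: heat_kernel_abs intro!: ennreal_leI)
next
  case (Suc n)
  let ?r = "\<bar>a\<bar> + \<bar>y - a\<bar> + 2 * real (Suc n) * \<epsilon>"
  have "heat_tail (Suc n) t ?r = (\<integral>\<^sup>+ x. ennreal (\<phi> x) * heat_tail (Suc n) t ?r \<partial>lborel)"
    by (simp add: nn_integral_multc bump_mass del: heat_tail.simps)
  also have "\<dots> \<le> (\<integral>\<^sup>+ x. ennreal (\<phi> x) *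
    (\<integral>\<^sup>+ s. indicator {0<..<t} s * visit_kernel \<phi> n s x * ennreal (heat_kernel (t - s) \<bar>y - x\<bar>) \<partial>lborel) \<partial>lborel)"
  proof (intro nn_integral_mono)
    fix x
    show "ennreal (\<phi> x) * heat_tail (Suc n) t ?r \<le> ennreal (\<phi> x) *
      (\<integral>\<^sup>+ s. indicator {0<..<t} s * visit_kernel \<phi> n s x * ennreal (heat_kernel (t - s) \<bar>y - x\<bar>) \<partial>lborel)"
    proof (cases "\<epsilon> < \<bar>x - a\<bar>")
      case False
      let ?q = "\<bar>a\<bar> + \<bar>x - a\<bar> + 2 * real n * \<epsilon>"
      have q: "?q \<ge> 0" using bump_width by simp
      have "heat_tail (Suc n) t ?r \<le> heat_tail (Suc n) t (?q + \<bar>y - x\<bar>)"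
        using False Suc.prems q by (intro heat_tail_antimono) (auto simp: algebra_simps)
      also have "\<dots> = (\<integral>\<^sup>+ s. indicator {0<..<t} s * heat_tail n s ?q * ennreal (heat_kernel (t - s) \<bar>y - x\<bar>) \<partial>lborel)"
        using convolution_heat_tail[OF Suc.prems, of "\<bar>y - x\<bar>" ?q n] q by simp
      also have "\<dots> \<le> (\<integral>\<^sup>+ s. indicator {0<..<t} s * visit_kernel \<phi> n s x * ennreal (heat_kernel (t - s) \<bar>y - x\<bar>) \<partial>lborel)"
        by (intro nn_integral_mono) (auto simp: indicator_def intro!: mult_right_mono Suc.IH)
      finally show ?thesis by (intro mult_left_mono) auto
    qed (simp add: bump_support)
  qed
  finally show ?case by (simp add: visit_kernel_Suc del: visit_kernel.simps heat_tail.simps)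
qed

text \<open>
  A way from \<open>0\<close> to \<open>y\<close> through at least one point of the bump falls short of \<open>\<bar>a\<bar> + \<bar>y - a\<bar>\<close>
  by at most \<open>2 \<epsilon>\<close>; the larger defect simplifies the induction.  Without a visit there is no such
  bound, since \<open>\<bar>y\<bar>\<close> may be much smaller than \<open>\<bar>a\<bar> + \<bar>y - a\<bar>\<close>.
\<close>

lemma visit_kernel_upper:
  "0 < t \<Longrightarrow> visit_kernel \<phi> (Suc n) t y \<le> heat_tail (Suc n) t (max 0 (\<bar>a\<bar> + \<bar>y - a\<bar> - 2 * real (Suc n) * \<epsilon>))"
proof (induction n arbitrary: t y)
  case 0
  let ?r = "max 0 (\<bar>a\<bar> + \<bar>y - a\<bar> - 2 * real (Suc 0) * \<epsilon>)"
  have "visit_kernel \<phi> (Suc 0) t y \<le> (\<integral>\<^sup>+ x. ennreal (\<phi> x) * heat_tail (Suc 0) t ?r \<partial>lborel)"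
    unfolding visit_kernel_Suc[OF bump_measurable]
  proof (intro nn_integral_mono)
    fix x
    show "ennreal (\<phi> x) * (\<integral>\<^sup>+ s. indicator {0<..<t} s * visit_kernel \<phi> 0 s x * ennreal (heat_kernel (t - s) \<bar>y - x\<bar>) \<partial>lborel)
        \<le> ennreal (\<phi> x) * heat_tail (Suc 0) t ?r"
    proof (cases "\<epsilon> < \<bar>x - a\<bar>")
      case False
      have "(\<integral>\<^sup>+ s. indicator {0<..<t} s * visit_kernel \<phi> 0 s x * ennreal (heat_kernel (t - s) \<bar>y - x\<bar>) \<partial>lborel)
        = heat_tail (Suc 0) t (\<bar>x\<bar> + \<bar>y - x\<bar>)"
        using convolution_heat_tail[OF 0, of "\<bar>y - x\<bar>" "\<bar>x\<bar>" 0] by (simp add: heat_kernel_abs del: heat_tail.simps(2))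
      also have "\<dots> \<le> heat_tail (Suc 0) t ?r"
        using False 0 by (intro heat_tail_antimono) auto
      finally show ?thesis by (intro mult_left_mono) auto
    qed (simp add: bump_support)
  qed
  then show ?case by (simp add: nn_integral_multc bump_mass del: heat_tail.simps visit_kernel.simps)
next
  case (Suc n)
  let ?r = "max 0 (\<bar>a\<bar> + \<bar>y - a\<bar> - 2 * real (Suc (Suc n)) * \<epsilon>)"
  have "visit_kernel \<phi> (Suc (Suc n)) t y \<le> (\<integral>\<^sup>+ x. ennreal (\<phi> x) * heat_tail (Suc (Suc n)) t ?r \<partial>lborel)"
    unfolding visit_kernel_Suc[OF bump_measurable, of "Suc n"]
  proof (intro nn_integral_mono)
    fix x
    let ?q = "max 0 (\<bar>a\<bar> + \<bar>x - a\<bar> - 2 * real (Suc n) * \<epsilon>)"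
    have "(\<integral>\<^sup>+ s. indicator {0<..<t} s * visit_kernel \<phi> (Suc n) s x * ennreal (heat_kernel (t - s) \<bar>y - x\<bar>) \<partial>lborel)
      \<le> (\<integral>\<^sup>+ s. indicator {0<..<t} s * heat_tail (Suc n) s ?q * ennreal (heat_kernel (t - s) \<bar>y - x\<bar>) \<partial>lborel)"
    proof (intro nn_integral_mono)
      fix s
      show "indicator {0<..<t} s * visit_kernel \<phi> (Suc n) s x * ennreal (heat_kernel (t - s) \<bar>y - x\<bar>)
        \<le> indicator {0<..<t} s * heat_tail (Suc n) s ?q * ennreal (heat_kernel (t - s) \<bar>y - x\<bar>)"
        using Suc.IH[of s x] by (cases "0 < s \<and> s < t") (auto simp del: heat_tail.simps visit_kernel.simps intro!: mult_right_mono)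
    qed
    also have "\<dots> = heat_tail (Suc (Suc n)) t (?q + \<bar>y - x\<bar>)"
      by (rule convolution_heat_tail) (use Suc.prems in auto)
    also have "\<dots> \<le> heat_tail (Suc (Suc n)) t ?r"
      using Suc.prems bump_width by (intro heat_tail_antimono) (auto simp: algebra_simps)
    finally show "ennreal (\<phi> x) * (\<integral>\<^sup>+ s. indicator {0<..<t} s * visit_kernel \<phi> (Suc n) s x * ennreal (heat_kernel (t - s) \<bar>y - x\<bar>) \<partial>lborel)
        \<le> ennreal (\<phi> x) * heat_tail (Suc (Suc n)) t ?r"
      by (intro mult_left_mono) auto
  qed
  then show ?case by (simp add: nn_integral_multc bump_mass del: heat_tail.simps visit_kernel.simps)
qed

text \<open>
  The two bounds above are tails at arguments shifted by \<open>\<delta>\<close>, and \<open>heat_tail_modulus\<close> removes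
  the shift.
\<close>

lemma visit_kernel_approx:
  fixes t y :: real and n :: nat
  assumes "0 < t"
  defines "\<delta> \<equiv> 2 * real (Suc n) * \<epsilon>"
  shows "heat_tail (Suc n) t (\<bar>a\<bar> + \<bar>y - a\<bar>) \<le> visit_kernel \<phi> (Suc n) t y + heat_tail n t 0 * ennreal \<delta>"
    and "visit_kernel \<phi> (Suc n) t y \<le> heat_tail (Suc n) t (\<bar>a\<bar> + \<bar>y - a\<bar>) + heat_tail n t 0 * ennreal \<delta>"
proof -
  let ?r = "\<bar>a\<bar> + \<bar>y - a\<bar>"
  have \<delta>: "\<delta> \<ge> 0" using bump_width by (simp add: \<delta>_def)
  have "heat_tail (Suc n) t ?r \<le> heat_tail (Suc n) t (?r + \<delta>) + heat_tail n t ?r * ennreal \<delta>"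
    using assms(1) \<delta> by (intro heat_tail_modulus) auto
  also have "\<dots> \<le> visit_kernel \<phi> (Suc n) t y + heat_tail n t 0 * ennreal \<delta>"
    using visit_kernel_lower[OF assms(1), of "Suc n" y] assms(1) unfolding \<delta>_def
    by (intro add_mono mult_right_mono heat_tail_antimono) auto
  finally show "heat_tail (Suc n) t ?r \<le> visit_kernel \<phi> (Suc n) t y + heat_tail n t 0 * ennreal \<delta>" .
  have "visit_kernel \<phi> (Suc n) t y \<le> heat_tail (Suc n) t (max 0 (?r - \<delta>))"
    unfolding \<delta>_def by (rule visit_kernel_upper[OF assms(1)])
  also have "\<dots> \<le> heat_tail (Suc n) t (max 0 (?r - \<delta>) + \<delta>) + heat_tail n t (max 0 (?r - \<delta>)) * ennreal \<delta>"
    using assms(1) \<delta> by (intro heat_tail_modulus) auto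
  also have "\<dots> \<le> heat_tail (Suc n) t ?r + heat_tail n t 0 * ennreal \<delta>"
  proof (intro add_mono mult_right_mono)
    show "heat_tail (Suc n) t (max 0 (?r - \<delta>) + \<delta>) \<le> heat_tail (Suc n) t ?r"
      using assms(1) by (intro heat_tail_antimono) auto
    show "heat_tail n t (max 0 (?r - \<delta>)) \<le> heat_tail n t 0"
      using assms(1) by (intro heat_tail_antimono) auto
  qed simp
  finally show "visit_kernel \<phi> (Suc n) t y \<le> heat_tail (Suc n) t ?r + heat_tail n t 0 * ennreal \<delta>" .
qed

text \<open>
  The defect \<open>2 (n + 1) \<epsilon>\<close> of \<open>visit_kernel_upper\<close> grows with \<open>n\<close>, but for \<open>\<epsilon> \<le> 1 / (2 \<beta>)\<close> it
  costs a factor of at most \<open>exp 1\<close> per visit.  The bound is thus geometric in \<open>n\<close> with a ratio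
  that is as small as desired, uniformly for all sufficiently narrow bumps.
\<close>

lemma visit_kernel_exp_bound:
  assumes "0 < t" "0 < \<beta>" "2 * \<beta> * \<epsilon> \<le> 1"
  shows "visit_kernel \<phi> (Suc n) t y
    \<le> ennreal (exp (\<beta>\<^sup>2 * t / 2) / sqrt (2 * pi * t) * (exp 1 / \<beta>) ^ Suc n * exp (- \<beta> * \<bar>y - a\<bar>))"
proof -
  let ?c = "exp (\<beta>\<^sup>2 * t / 2) / sqrt (2 * pi * t)"
  let ?s = "max 0 (\<bar>a\<bar> + \<bar>y - a\<bar> - 2 * real (Suc n) * \<epsilon>)"
  have "visit_kernel \<phi> (Suc n) t y \<le> heat_tail (Suc n) t ?s"
    by (rule visit_kernel_upper[OF assms(1)])
  also have "\<dots> \<le> ennreal (?c / \<beta> ^ Suc n * exp (- \<beta> * ?s))"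
    by (rule heat_tail_exp_bound[OF assms(1,2)])
  also have "\<dots> \<le> ennreal (?c / \<beta> ^ Suc n * (exp 1 ^ Suc n * exp (- \<beta> * \<bar>y - a\<bar>)))"
  proof (intro ennreal_leI mult_left_mono)
    have "\<beta> * ?s \<ge> \<beta> * (\<bar>y - a\<bar> - 2 * real (Suc n) * \<epsilon>)"
      using assms(2) by (intro mult_left_mono) auto
    moreover have "\<beta> * (2 * real (Suc n) * \<epsilon>) \<le> real (Suc n)"
      using mult_right_mono[OF assms(3), of "real (Suc n)"] by (simp add: mult_ac)
    ultimately have "- \<beta> * ?s \<le> real (Suc n) + - \<beta> * \<bar>y - a\<bar>" by (simp add: algebra_simps)
    then have "exp (- \<beta> * ?s) \<le> exp (real (Suc n) + - \<beta> * \<bar>y - a\<bar>)" by (simp only: exp_le_cancel_iff)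
    also have "\<dots> = exp 1 ^ Suc n * exp (- \<beta> * \<bar>y - a\<bar>)"
      by (simp only: exp_add exp_of_nat_mult[of _ 1, symmetric] mult_1_right)
    finally show "exp (- \<beta> * ?s) \<le> exp 1 ^ Suc n * exp (- \<beta> * \<bar>y - a\<bar>)" .
  qed (use assms in auto)
  also have "?c / \<beta> ^ Suc n * (exp 1 ^ Suc n * exp (- \<beta> * \<bar>y - a\<bar>)) = ?c * (exp 1 / \<beta>) ^ Suc n * exp (- \<beta> * \<bar>y - a\<bar>)"
    by (simp only: power_divide) simp
  finally show ?thesis .
qed

end

section \<open>The limit of a shrinking bump\<close>

lemma nn_integral_exp_abs:
  fixes \<beta> a :: real
  assumes "\<beta> > 0"
  shows "(\<integral>\<^sup>+ y. ennreal (exp (- \<beta> * \<bar>y - a\<bar>)) \<partial>lborel) \<le> ennreal (2 / \<beta>)"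
proof -
  have half: "(\<integral>\<^sup>+ u. ennreal (exp (- \<beta> * u)) * indicator {0..} u \<partial>lborel) = ennreal (1 / \<beta>)"
    using nn_integral_exp_tail[OF assms, of 0] by simp
  have "(\<integral>\<^sup>+ y. ennreal (exp (- \<beta> * \<bar>y - a\<bar>)) \<partial>lborel) = (\<integral>\<^sup>+ u. ennreal (exp (- \<beta> * \<bar>u\<bar>)) \<partial>lborel)"
    by (subst nn_integral_real_affine[where c=1 and t=a]) auto
  also have "\<dots> \<le> (\<integral>\<^sup>+ u. ennreal (exp (- \<beta> * u)) * indicator {0..} u + ennreal (exp (- \<beta> * (- u))) * indicator {0..} (- u) \<partial>lborel)"
    by (intro nn_integral_mono) (auto simp: indicator_def)
  also have "\<dots> = ennreal (1 / \<beta>) + (\<integral>\<^sup>+ u. ennreal (exp (- \<beta> * (- u))) * indicator {0..} (- u) \<partial>lborel)"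
    unfolding half[symmetric] by (rule nn_integral_add) auto
  also have "(\<integral>\<^sup>+ u. ennreal (exp (- \<beta> * (- u))) * indicator {0..} (- u) \<partial>lborel) = ennreal (1 / \<beta>)"
  proof -
    have "(\<integral>\<^sup>+ u. ennreal (exp (- \<beta> * u)) * indicator {0..} u \<partial>lborel) = ennreal \<bar>- 1\<bar> *
      (\<integral>\<^sup>+ u. ennreal (exp (- \<beta> * (0 + - 1 * u))) * indicator {0..} (0 + - 1 * u) \<partial>lborel)"
      by (rule nn_integral_real_affine) auto
    from trans[OF this[symmetric] half] show ?thesis by simp
  qed
  also have "ennreal (1 / \<beta>) + ennreal (1 / \<beta>) = ennreal (2 / \<beta>)"
    using assms by (simp add: ennreal_plus[symmetric] del: ennreal_plus)
  finally show ?thesis .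
qed

text \<open>
  The limit of the visit kernels as the bump shrinks to \<open>a\<close>.  The case \<open>n = 0\<close> is separate
  because the way from \<open>0\<close> to \<open>y\<close> then makes no detour to the level.
\<close>

definition limit_kernel :: "real \<Rightarrow> nat \<Rightarrow> real \<Rightarrow> real \<Rightarrow> ennreal" where
  "limit_kernel a n t y = (if n = 0 then ennreal (heat_kernel t y) else heat_tail n t (\<bar>a\<bar> + \<bar>y - a\<bar>))"

lemma measurable_limit_kernel [measurable]: "limit_kernel a n t \<in> borel_measurable borel"
  unfolding limit_kernel_def by measurable

lemma visit_kernel_tendsto:
  assumes t: "0 < t" and \<phi>: "\<And>k. bump (\<phi> k) a (\<epsilon> k)" and \<epsilon>: "\<epsilon> \<longlonglongrightarrow> 0"
  shows "(\<lambda>k. visit_kernel (\<phi> k) n t y) \<longlonglongrightarrow> limit_kernel a n t y"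
proof (cases n)
  case (Suc m)
  let ?H = "heat_tail (Suc m) t (\<bar>a\<bar> + \<bar>y - a\<bar>)"
  let ?d = "\<lambda>k. heat_tail m t 0 * ennreal (2 * real (Suc m) * \<epsilon> k)"
  have "(\<lambda>k. ennreal (2 * real (Suc m) * \<epsilon> k)) \<longlonglongrightarrow> ennreal (2 * real (Suc m) * 0)"
    by (intro tendsto_ennrealI tendsto_intros \<epsilon>)
  then have "?d \<longlonglongrightarrow> heat_tail m t 0 * ennreal (2 * real (Suc m) * 0)"
    by (intro ennreal_tendsto_cmult heat_tail_finite t)
  then have d: "?d \<longlonglongrightarrow> 0" by simp
  have up: "(\<lambda>k. ?H + ?d k) \<longlonglongrightarrow> ?H + 0" by (intro tendsto_add tendsto_const d)
  have lo: "(\<lambda>k. ?H - ?d k) \<longlonglongrightarrow> ?H - 0"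
  proof (rule tendsto_diff_ennreal[OF tendsto_const d])
    show "?H \<noteq> top" using heat_tail_finite[OF t] by (metis less_irrefl)
  qed simp
  have "(\<lambda>k. visit_kernel (\<phi> k) (Suc m) t y) \<longlonglongrightarrow> ?H"
  proof (rule tendsto_sandwich)
    show "\<forall>\<^sub>F k in sequentially. ?H - ?d k \<le> visit_kernel (\<phi> k) (Suc m) t y"
    proof (rule always_eventually, rule allI)
      fix k interpret bump "\<phi> k" a "\<epsilon> k" by (rule \<phi>)
      show "?H - ?d k \<le> visit_kernel (\<phi> k) (Suc m) t y"
        using visit_kernel_approx(1)[OF t, of m y] heat_tail_finite[OF t, of "Suc m"]
        by (metis ennreal_minus_le_iff add.commute less_irrefl)
    qed
    show "\<forall>\<^sub>F k in sequentially. visit_kernel (\<phi> k) (Suc m) t y \<le> ?H + ?d k"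
    proof (rule always_eventually, rule allI)
      fix k interpret bump "\<phi> k" a "\<epsilon> k" by (rule \<phi>)
      show "visit_kernel (\<phi> k) (Suc m) t y \<le> ?H + ?d k"
        by (rule visit_kernel_approx(2)[OF t])
    qed
  qed (use up lo in auto)
  then show ?thesis by (simp add: Suc limit_kernel_def del: heat_tail.simps visit_kernel.simps)
qed (simp add: limit_kernel_def)

lemma (in bump) visit_moment_bound:
  assumes "0 < t" "0 < \<beta>" "2 * \<beta> * \<epsilon> \<le> 1"
  shows "(\<integral>\<^sup>+ y. indicator A y * visit_kernel \<phi> (Suc n) t y \<partial>lborel)
    \<le> ennreal (exp (\<beta>\<^sup>2 * t / 2) / sqrt (2 * pi * t) * (exp 1 / \<beta>) ^ Suc n * (2 / \<beta>))"
proof -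
  let ?c = "exp (\<beta>\<^sup>2 * t / 2) / sqrt (2 * pi * t) * (exp 1 / \<beta>) ^ Suc n"
  have c: "?c \<ge> 0" using assms by (intro mult_nonneg_nonneg divide_nonneg_nonneg zero_le_power) auto
  have "(\<integral>\<^sup>+ y. indicator A y * visit_kernel \<phi> (Suc n) t y \<partial>lborel) \<le> (\<integral>\<^sup>+ y. ennreal ?c * ennreal (exp (- \<beta> * \<bar>y - a\<bar>)) \<partial>lborel)"
  proof (intro nn_integral_mono)
    fix y
    have "indicator A y * visit_kernel \<phi> (Suc n) t y \<le> 1 * visit_kernel \<phi> (Suc n) t y"
      by (intro mult_right_mono) (auto simp: indicator_def)
    also have "\<dots> \<le> ennreal (?c * exp (- \<beta> * \<bar>y - a\<bar>))"
      using visit_kernel_exp_bound[OF assms] by (simp only: mult_1)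
    finally show "indicator A y * visit_kernel \<phi> (Suc n) t y \<le> ennreal ?c * ennreal (exp (- \<beta> * \<bar>y - a\<bar>))"
      by (simp only: ennreal_mult'[OF c])
  qed
  also have "\<dots> = ennreal ?c * (\<integral>\<^sup>+ y. ennreal (exp (- \<beta> * \<bar>y - a\<bar>)) \<partial>lborel)"
    by (rule nn_integral_cmult) simp
  also have "\<dots> \<le> ennreal ?c * ennreal (2 / \<beta>)"
    using assms(2) by (intro mult_left_mono nn_integral_exp_abs) auto
  finally show ?thesis by (simp only: ennreal_mult'[OF c])
qed

lemma visit_moment_tendsto:
  assumes t: "0 < t" and \<phi>: "\<And>k. bump (\<phi> k) a (\<epsilon> k)" and \<epsilon>: "\<epsilon> \<longlonglongrightarrow> 0" "\<And>k. \<epsilon> k \<le> 1 / 2"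
    and A [measurable]: "A \<in> sets borel"
  shows "(\<lambda>k. \<integral>\<^sup>+ y. indicator A y * visit_kernel (\<phi> k) n t y \<partial>lborel) \<longlonglongrightarrow> (\<integral>\<^sup>+ y. indicator A y * limit_kernel a n t y \<partial>lborel)"
proof (cases n)
  case 0
  then show ?thesis by (simp add: limit_kernel_def)
next
  case (Suc m)
  let ?c = "exp (t / 2) / sqrt (2 * pi * t) * exp 1 ^ Suc m"
  have [measurable]: "\<phi> k \<in> borel_measurable borel" for k using \<phi>[of k] by (simp add: bump_def)
  note [measurable] = measurable_visit_kernel
  show ?thesis unfolding Suc
  proof (rule nn_integral_dominated_convergence[where w="\<lambda>y. ennreal ?c * ennreal (exp (- \<bar>y - a\<bar>))"])
    show "AE y in lborel. indicator A y * visit_kernel (\<phi> k) (Suc m) t y \<le> ennreal ?c * ennreal (exp (- \<bar>y - a\<bar>))" for k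
    proof (rule AE_I2)
      fix y
      interpret bump "\<phi> k" a "\<epsilon> k" by (rule \<phi>)
      have "indicator A y * visit_kernel (\<phi> k) (Suc m) t y \<le> 1 * visit_kernel (\<phi> k) (Suc m) t y"
        by (intro mult_right_mono) (auto simp: indicator_def)
      also have "\<dots> \<le> ennreal (?c * exp (- \<bar>y - a\<bar>))"
        using visit_kernel_exp_bound[OF t, of 1 m y] \<epsilon>(2)[of k] by (simp del: visit_kernel.simps power_Suc)
      also have "\<dots> = ennreal ?c * ennreal (exp (- \<bar>y - a\<bar>))"
        using t by (intro ennreal_mult') auto
      finally show "indicator A y * visit_kernel (\<phi> k) (Suc m) t y \<le> ennreal ?c * ennreal (exp (- \<bar>y - a\<bar>))" .
    qed
    have "(\<integral>\<^sup>+ y. ennreal (exp (- \<bar>y - a\<bar>)) \<partial>lborel) \<le> ennreal 2"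
      using nn_integral_exp_abs[of 1 a] by simp
    also have "\<dots> < \<infinity>" by simp
    finally show "(\<integral>\<^sup>+ y. ennreal ?c * ennreal (exp (- \<bar>y - a\<bar>)) \<partial>lborel) < \<infinity>"
      by (subst nn_integral_cmult) (auto simp: ennreal_mult_less_top)
    show "AE y in lborel. (\<lambda>k. indicator A y * visit_kernel (\<phi> k) (Suc m) t y) \<longlonglongrightarrow> indicator A y * limit_kernel a (Suc m) t y"
      by (intro AE_I2 ennreal_tendsto_cmult visit_kernel_tendsto[OF t \<phi> \<epsilon>(1)]) (auto simp: indicator_def)
  qed (simp_all del: visit_kernel.simps)
qed

section \<open>The Markov property with respect to the occupation time\<close>

text \<open>
  By the mean value theorem, each increment of the primitive over a cell is the length of the cell
  times a value of \<open>g\<close> in that cell.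
\<close>

lemma riemann_sum_tendsto_integral:
  fixes g :: "real \<Rightarrow> real"
  assumes cont: "continuous_on UNIV g" and s: "0 < s"
  shows "(\<lambda>N. s / real (Suc N) * (\<Sum>k<Suc N. g (real k * s / real (Suc N)))) \<longlonglongrightarrow> (LBINT r=0..s. g r)"
proof (rule LIMSEQ_I)
  fix e :: real assume "0 < e"
  define e' where "e' = e / (2 * s)"
  have e': "e' > 0" using \<open>0 < e\<close> s by (simp add: e'_def)
  define F where "F = (\<lambda>x::real. LBINT r=0..x. g r)"
  have F': "DERIV F x :> g x" for x
    unfolding F_def by (rule interval_integral_has_derivative[OF cont])
  have F0: "F 0 = 0" by (simp add: F_def zero_ereal_def)
  have "uniformly_continuous_on {0..s} g"
    by (intro compact_uniformly_continuous continuous_on_subset[OF cont]) auto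
  then obtain d where d: "d > 0" "\<And>x y. x \<in> {0..s} \<Longrightarrow> y \<in> {0..s} \<Longrightarrow> dist y x < d \<Longrightarrow> dist (g y) (g x) < e'"
    using e' unfolding uniformly_continuous_on_def by metis
  obtain N0 where N0: "s / real (Suc N0) < d"
    using reals_Archimedean2[of "s / d"] d(1) by (metis divide_less_eq less_Suc_eq mult.commute of_nat_less_iff of_nat_0_less_iff order.strict_trans zero_less_Suc)
  show "\<exists>no. \<forall>N\<ge>no. norm (s / real (Suc N) * (\<Sum>k<Suc N. g (real k * s / real (Suc N))) - (LBINT r=0..s. g r)) < e"
  proof (intro exI allI impI)
    fix N assume N: "N0 \<le> N"
    define h where "h = s / real (Suc N)"
    have h: "h > 0" using s by (simp add: h_def)
    have hd: "h < d"
    proof -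
      have "h \<le> s / real (Suc N0)" unfolding h_def using s N by (intro divide_left_mono) auto
      then show ?thesis using N0 by simp
    qed
    have sN: "real (Suc N) * h = s" by (simp add: h_def)
    have cell: "\<bar>h * g (real k * h) - (F (real (Suc k) * h) - F (real k * h))\<bar> \<le> h * e'" if "k < Suc N" for k
    proof -
      have "real k * h < real (Suc k) * h" using h by simp
      from MVT2[OF this, of F g] F' obtain z where
        z: "real k * h < z" "z < real (Suc k) * h" "F (real (Suc k) * h) - F (real k * h) = (real (Suc k) * h - real k * h) * g z"
        by auto
      have up: "real (Suc k) * h \<le> s"
        unfolding sN[symmetric] using that h by (intro mult_right_mono) auto
      have "dist (g z) (g (real k * h)) < e'"
      proof (rule d(2))
        have "0 \<le> real k * h" using h by simp
        then show "real k * h \<in> {0..s}" "z \<in> {0..s}" using z up by auto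
        show "dist z (real k * h) < d" using z hd by (simp add: dist_real_def algebra_simps)
      qed
      then have "\<bar>g (real k * h) - g z\<bar> \<le> e'" by (simp add: dist_real_def)
      moreover have "h * g (real k * h) - (F (real (Suc k) * h) - F (real k * h)) = h * (g (real k * h) - g z)"
        unfolding z(3) by (simp add: algebra_simps)
      ultimately show ?thesis using h by (simp add: abs_mult)
    qed
    have "(\<Sum>k<Suc N. F (real (Suc k) * h) - F (real k * h)) = F s"
      using sum_lessThan_telescope[of "\<lambda>k. F (real k * h)" "Suc N"] sN F0 by simp
    then have "h * (\<Sum>k<Suc N. g (real k * h)) - F s = (\<Sum>k<Suc N. h * g (real k * h) - (F (real (Suc k) * h) - F (real k * h)))"
      by (simp only: sum_subtractf sum_distrib_left)
    also have "\<bar>\<dots>\<bar> \<le> (\<Sum>k<Suc N. h * e')"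
      by (intro order_trans[OF sum_abs] sum_mono cell) simp
    also have "\<dots> = real (Suc N) * h * e'" by simp
    also have "\<dots> = s * e'" unfolding sN ..
    also have "\<dots> < e" using \<open>0 < e\<close> s by (simp add: e'_def)
    finally show "norm (s / real (Suc N) * (\<Sum>k<Suc N. g (real k * s / real (Suc N))) - (LBINT r=0..s. g r)) < e"
      by (simp add: h_def F_def)
  qed
qed

lemma (in prob_space) nn_integral_indep_pair:
  assumes ind: "indep_var S X T Y" and F: "(\<lambda>(x, y). F x y) \<in> borel_measurable (S \<Otimes>\<^sub>M T)"
  shows "(\<integral>\<^sup>+ \<omega>. F (X \<omega>) (Y \<omega>) \<partial>M) = (\<integral>\<^sup>+ \<omega>. (\<integral>\<^sup>+ x. F x (Y \<omega>) \<partial>distr M S X) \<partial>M)"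
proof -
  from ind have [measurable]: "X \<in> M \<rightarrow>\<^sub>M S" "Y \<in> M \<rightarrow>\<^sub>M T"
    and eq: "distr M S X \<Otimes>\<^sub>M distr M T Y = distr M (S \<Otimes>\<^sub>M T) (\<lambda>\<omega>. (X \<omega>, Y \<omega>))"
    by (auto simp: indep_var_distribution_eq)
  note [measurable] = F
  interpret X: prob_space "distr M S X" by (rule prob_space_distr) simp
  interpret Y: prob_space "distr M T Y" by (rule prob_space_distr) simp
  interpret XY: pair_sigma_finite "distr M S X" "distr M T Y" ..
  have "(\<integral>\<^sup>+ \<omega>. F (X \<omega>) (Y \<omega>) \<partial>M) = (\<integral>\<^sup>+ p. F (fst p) (snd p) \<partial>(distr M S X \<Otimes>\<^sub>M distr M T Y))"
    unfolding eq by (subst nn_integral_distr) (use F in \<open>simp_all add: split_beta\<close>)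
  also have "\<dots> = (\<integral>\<^sup>+ y. (\<integral>\<^sup>+ x. F x y \<partial>distr M S X) \<partial>distr M T Y)"
    using F by (subst XY.nn_integral_snd[symmetric]) (auto simp: split_beta cong: measurable_cong_sets)
  also have "\<dots> = (\<integral>\<^sup>+ \<omega>. (\<integral>\<^sup>+ x. F x (Y \<omega>) \<partial>distr M S X) \<partial>M)"
    by (subst nn_integral_distr) (use F in auto)
  finally show ?thesis .
qed

text \<open>
  Everywhere continuous paths make the process jointly measurable in time and \<open>\<omega>\<close>, which
  interchanging expectations with integrals over time requires.
\<close>

locale continuous_brownian_motion = standard_brownian_motion M B
  for M :: "'w measure" and B :: "real \<Rightarrow> 'w \<Rightarrow> real" +
  assumes measurable_B [measurable]: "B s \<in> borel_measurable M"
    and start: "B 0 \<omega> = 0"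
    and paths: "continuous_on UNIV (\<lambda>s. B s \<omega>)"
begin

text \<open>
  By continuity, the process is the limit of its values at the times rounded down to multiples of
  \<open>1 / (i + 1)\<close>, which are countably many.
\<close>

lemma jointly_measurable:
  "(\<lambda>(s, \<omega>). B s \<omega>) \<in> borel_measurable (borel \<Otimes>\<^sub>M M)"
proof (rule borel_measurable_LIMSEQ_real)
  fix p :: "real \<times> 'w"
  obtain s \<omega> where p: "p = (s, \<omega>)" by force
  have "isCont (\<lambda>s. B s \<omega>) s" using paths[of \<omega>] by (simp add: continuous_on_eq_continuous_at)
  moreover have "(\<lambda>i. of_int \<lfloor>s * real (Suc i)\<rfloor> / real (Suc i)) \<longlonglongrightarrow> s"
    by real_asymp
  ultimately show "(\<lambda>i. (\<lambda>(s, \<omega>). B (of_int \<lfloor>s * real (Suc i)\<rfloor> / real (Suc i)) \<omega>) p) \<longlonglongrightarrow> (case p of (s, \<omega>) \<Rightarrow> B s \<omega>)"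
    unfolding p prod.case by (rule isCont_tendsto_compose)
next
  fix i
  have "(\<lambda>p. (\<lambda>k p. B (of_int k / real (Suc i)) (snd p)) \<lfloor>fst p * real (Suc i)\<rfloor> p) \<in> borel_measurable (borel \<Otimes>\<^sub>M M)"
    by (rule measurable_compose_countable) measurable
  then show "(\<lambda>(s, \<omega>). B (of_int \<lfloor>s * real (Suc i)\<rfloor> / real (Suc i)) \<omega>) \<in> borel_measurable (borel \<Otimes>\<^sub>M M)"
    by (simp add: split_beta)
qed

lemma measurable_B_compose [measurable (raw)]:
  assumes "f \<in> borel_measurable N" "g \<in> N \<rightarrow>\<^sub>M M"
  shows "(\<lambda>x. B (f x) (g x)) \<in> borel_measurable N"
proof -
  have "(\<lambda>x. (f x, g x)) \<in> N \<rightarrow>\<^sub>M borel \<Otimes>\<^sub>M M" using assms by simp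
  from measurable_compose[OF this jointly_measurable] show ?thesis by simp
qed

lemma distr_increment:
  assumes "0 \<le> s" "s < t"
  shows "distr M borel (\<lambda>\<omega>. B t \<omega> - B s \<omega>) = density lborel (\<lambda>x. ennreal (heat_kernel (t - s) x))"
proof -
  have "distr M lborel (\<lambda>\<omega>. B t \<omega> - B s \<omega>) = density lborel (\<lambda>x. ennreal (normal_density 0 (sqrt (t - s)) x))"
    using gaussian_increments[OF assms] by (simp add: distributed_def)
  moreover have "distr M lborel (\<lambda>\<omega>. B t \<omega> - B s \<omega>) = distr M borel (\<lambda>\<omega>. B t \<omega> - B s \<omega>)"
    by (rule distr_cong) auto
  ultimately show ?thesis using assms by (simp add: normal_density_heat_kernel)
qed

lemma distr_position: "0 < t \<Longrightarrow> distr M borel (B t) = density lborel (\<lambda>x. ennreal (heat_kernel t x))"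
  using distr_increment[of 0 t] by (simp add: start)

text \<open>
  The Markov property for Riemann sums of the occupation time.  Both \<open>B s\<close> and the Riemann sum
  \<open>R\<close> are functions of the increments over the grid up to \<open>s\<close>, which are independent of the
  increment from \<open>s\<close> to \<open>t\<close>.
\<close>

lemma nn_integral_increment_grid:
  fixes \<phi> :: "real \<Rightarrow> real" and F :: "real \<Rightarrow> real \<Rightarrow> real \<Rightarrow> ennreal" and s t :: real and N :: nat
  assumes [measurable]: "\<phi> \<in> borel_measurable borel" and st: "0 < s" "s < t"
    and F [measurable]: "(\<lambda>(x, y, z). F x y z) \<in> borel_measurable (borel \<Otimes>\<^sub>M borel \<Otimes>\<^sub>M borel)"
  defines "R \<equiv> \<lambda>\<omega>. s / real (Suc N) * (\<Sum>k<Suc N. \<phi> (B (real k * s / real (Suc N)) \<omega>))"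
  shows "(\<integral>\<^sup>+ \<omega>. F (B t \<omega> - B s \<omega>) (B s \<omega>) (R \<omega>) \<partial>M) =
    (\<integral>\<^sup>+ \<omega>. (\<integral>\<^sup>+ x. F x (B s \<omega>) (R \<omega>) \<partial>distr M borel (\<lambda>\<omega>. B t \<omega> - B s \<omega>)) \<partial>M)"
proof -
  \<comment> \<open>The grid consists of the multiples of \<open>s / (N + 1)\<close> up to \<open>s\<close>, followed by \<open>t\<close>.\<close>
  define \<tau> where "\<tau> = (\<lambda>k. if k \<le> Suc N then real k * s / real (Suc N) else t)"
  have mono: "strict_mono_on {..Suc (Suc N)} \<tau>"
  proof (rule strict_mono_onI)
    fix i j assume ij: "i \<in> {..Suc (Suc N)}" "j \<in> {..Suc (Suc N)}" "i < j"
    have "real i * s / real (Suc N) \<le> s" if "i \<le> Suc N" for i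
      using that st by (simp add: divide_le_eq mult.commute mult_right_mono)
    from this[of i] show "\<tau> i < \<tau> j" using ij st
      by (auto simp: \<tau>_def divide_strict_right_mono)
  qed
  define X where "X = (\<lambda>i \<omega>. B (\<tau> (Suc i)) \<omega> - B (\<tau> i) \<omega>)"
  define U where "U = (\<lambda>\<omega>. restrict (\<lambda>i. X i \<omega>) {Suc N})"
  define V where "V = (\<lambda>\<omega>. restrict (\<lambda>i. X i \<omega>) {..<Suc N})"
  define P where "P = (\<lambda>f::nat \<Rightarrow> real. \<Sum>j<Suc N. f j)"
  define Q where "Q = (\<lambda>f::nat \<Rightarrow> real. s / real (Suc N) * (\<Sum>k<Suc N. \<phi> (\<Sum>j<k. f j)))"
  have ind: "indep_vars (\<lambda>_. borel) X {..<Suc (Suc N)}"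
    unfolding X_def using mono by (intro independent_increments) (simp add: \<tau>_def)
  have UV: "indep_var (PiM {Suc N} (\<lambda>_. borel)) U (PiM {..<Suc N} (\<lambda>_. borel)) V"
    unfolding U_def V_def by (rule indep_var_restrict[OF ind]) auto
  then have Um: "U \<in> M \<rightarrow>\<^sub>M PiM {Suc N} (\<lambda>_. borel)" by (rule indep_var_rv1)
  have last [measurable]: "(\<lambda>f. f (Suc N)) \<in> Pi\<^sub>M {Suc N} (\<lambda>_. borel) \<rightarrow>\<^sub>M (borel :: real measure)"
    by (rule measurable_component_singleton) simp
  have partial: "(\<lambda>f. \<Sum>j<k. f j) \<in> borel_measurable (Pi\<^sub>M {..<Suc N} (\<lambda>_. borel :: real measure))" if "k \<le> Suc N" for k
    using that by (intro borel_measurable_sum measurable_component_singleton) auto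
  have [measurable]: "P \<in> borel_measurable (Pi\<^sub>M {..<Suc N} (\<lambda>_. borel))"
    unfolding P_def by (rule partial) simp
  have [measurable]: "Q \<in> borel_measurable (Pi\<^sub>M {..<Suc N} (\<lambda>_. borel))"
    unfolding Q_def
    by (intro borel_measurable_times borel_measurable_const borel_measurable_sum
            measurable_compose[OF partial assms(1)]) auto
  have U_last: "U \<omega> (Suc N) = B t \<omega> - B s \<omega>" for \<omega>
    by (auto simp: U_def X_def \<tau>_def)
  have tel: "(\<Sum>j<k. V \<omega> j) = B (real k * s / real (Suc N)) \<omega>" if "k \<le> Suc N" for k \<omega>
  proof -
    have "(\<Sum>j<k. V \<omega> j) = (\<Sum>j<k. B (\<tau> (Suc j)) \<omega> - B (\<tau> j) \<omega>)"
      using that by (intro sum.cong) (auto simp: X_def V_def)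
    also have "\<dots> = B (\<tau> k) \<omega> - B (\<tau> 0) \<omega>"
      by (rule sum_lessThan_telescope)
    finally show ?thesis using that by (simp add: \<tau>_def start)
  qed
  have PV: "P (V \<omega>) = B s \<omega>" for \<omega> using tel[of "Suc N" \<omega>] by (simp add: P_def del: sum.lessThan_Suc)
  have QV: "Q (V \<omega>) = R \<omega>" for \<omega>
    unfolding Q_def R_def by (intro sum.cong refl arg_cong[where f=\<phi>] arg_cong2[where f="(*)"] tel) auto
  have "(\<integral>\<^sup>+ \<omega>. F (U \<omega> (Suc N)) (P (V \<omega>)) (Q (V \<omega>)) \<partial>M) =
    (\<integral>\<^sup>+ \<omega>. (\<integral>\<^sup>+ x. F (x (Suc N)) (P (V \<omega>)) (Q (V \<omega>)) \<partial>distr M (PiM {Suc N} (\<lambda>_. borel)) U) \<partial>M)"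
  proof (rule nn_integral_indep_pair[OF UV])
    have "(\<lambda>p. (fst p (Suc N), P (snd p), Q (snd p))) \<in> PiM {Suc N} (\<lambda>_. borel) \<Otimes>\<^sub>M PiM {..<Suc N} (\<lambda>_. borel)
        \<rightarrow>\<^sub>M borel \<Otimes>\<^sub>M borel \<Otimes>\<^sub>M borel"
      by measurable
    from measurable_compose[OF this F]
    show "(\<lambda>(x, y). F (x (Suc N)) (P y) (Q y)) \<in> borel_measurable (PiM {Suc N} (\<lambda>_. borel) \<Otimes>\<^sub>M PiM {..<Suc N} (\<lambda>_. borel))"
      by (simp add: split_beta)
  qed
  also have "\<dots> = (\<integral>\<^sup>+ \<omega>. (\<integral>\<^sup>+ x. F x (P (V \<omega>)) (Q (V \<omega>)) \<partial>distr M borel (\<lambda>\<omega>. B t \<omega> - B s \<omega>)) \<partial>M)"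
  proof (intro nn_integral_cong)
    fix \<omega>
    have [measurable]: "(\<lambda>x. F x y z) \<in> borel_measurable borel" for y z
    proof -
      have "(\<lambda>x. (x, y, z)) \<in> borel \<rightarrow>\<^sub>M borel \<Otimes>\<^sub>M borel \<Otimes>\<^sub>M borel" by measurable
      from measurable_compose[OF this F] show ?thesis by simp
    qed
    show "(\<integral>\<^sup>+ x. F (x (Suc N)) (P (V \<omega>)) (Q (V \<omega>)) \<partial>distr M (PiM {Suc N} (\<lambda>_. borel)) U) =
       (\<integral>\<^sup>+ x. F x (P (V \<omega>)) (Q (V \<omega>)) \<partial>distr M borel (\<lambda>\<omega>. B t \<omega> - B s \<omega>))"
      using measurable_compose[OF last, of "\<lambda>x. F x (P (V \<omega>)) (Q (V \<omega>))"]
      by (simp add: nn_integral_distr[OF Um] nn_integral_distr U_last)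
  qed
  finally show ?thesis by (simp add: PV QV U_last)
qed

end

definition heat_semigroup :: "real \<Rightarrow> (real \<Rightarrow> ennreal) \<Rightarrow> real \<Rightarrow> ennreal" where
  "heat_semigroup t f x = (\<integral>\<^sup>+ y. f y * ennreal (heat_kernel t (y - x)) \<partial>lborel)"

lemma heat_semigroup_measurable [measurable (raw)]:
  assumes [measurable]: "f \<in> borel_measurable borel" "g \<in> borel_measurable N"
  shows "(\<lambda>x. heat_semigroup t f (g x)) \<in> borel_measurable N"
  unfolding heat_semigroup_def by measurable

lemma heat_semigroup_translate:
  assumes [measurable]: "f \<in> borel_measurable borel"
  shows "(\<integral>\<^sup>+ x. f (y + x) * ennreal (heat_kernel t x) \<partial>lborel) = heat_semigroup t f y"
  unfolding heat_semigroup_def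
  by (subst (2) nn_integral_real_affine[where c=1 and t=y]) auto

lemma heat_semigroup_bound:
  assumes [measurable]: "f \<in> borel_measurable borel" and "\<And>x. f x \<le> C" "0 < t"
  shows "heat_semigroup t f x \<le> C"
proof -
  have "heat_semigroup t f x = (\<integral>\<^sup>+ z. f (x + z) * ennreal (heat_kernel t z) \<partial>lborel)"
    by (rule heat_semigroup_translate[symmetric]) simp
  also have "\<dots> \<le> (\<integral>\<^sup>+ z. C * ennreal (heat_kernel t z) \<partial>lborel)"
    using assms by (intro nn_integral_mono mult_right_mono) auto
  also have "\<dots> = C" using assms by (simp add: nn_integral_cmult nn_integral_heat_kernel)
  finally show ?thesis .
qed

context continuous_brownian_motion
begin

definition occupation :: "(real \<Rightarrow> real) \<Rightarrow> real \<Rightarrow> 'w \<Rightarrow> real" where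
  "occupation \<phi> s \<omega> = (LBINT r:{0..s}. \<phi> (B r \<omega>))"

lemma occupation_interval: "0 \<le> s \<Longrightarrow> occupation \<phi> s \<omega> = (LBINT r=0..s. \<phi> (B r \<omega>))"
  unfolding occupation_def zero_ereal_def by (simp add: interval_integral_Icc)

lemma occupation_measurable [measurable (raw)]:
  assumes [measurable]: "\<phi> \<in> borel_measurable borel" "f \<in> borel_measurable N" "g \<in> N \<rightarrow>\<^sub>M M"
  shows "(\<lambda>x. occupation \<phi> (f x) (g x)) \<in> borel_measurable N"
  unfolding occupation_def set_lebesgue_integral_def
  by (rule lborel.borel_measurable_lebesgue_integral) (simp add: split_beta indicator_def)

lemma occupation_nonneg: "(\<And>x. 0 \<le> \<phi> x) \<Longrightarrow> 0 \<le> occupation \<phi> s \<omega>"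
  unfolding occupation_def set_lebesgue_integral_def by (intro Bochner_Integration.integral_nonneg) simp

lemma continuous_along_path:
  assumes "continuous_on UNIV \<phi>"
  shows "continuous_on UNIV (\<lambda>r. \<phi> (B r \<omega>))"
  by (rule continuous_on_compose2[OF assms paths]) auto

text \<open>
  The right side as a function of \<open>t\<close> has the integrand of the left side as its derivative.  This
  orders the visits: the last one is singled out, at time \<open>s\<close>.
\<close>

lemma occupation_power:
  assumes cont: "continuous_on UNIV \<phi>" and nonneg: "\<And>x. 0 \<le> \<phi> x" and t: "0 < t"
  shows "(\<integral>\<^sup>+ s. indicator {0<..<t} s * ennreal (\<phi> (B s \<omega>)) * ennreal (occupation \<phi> s \<omega> ^ n / fact n) \<partial>lborel)
     = ennreal (occupation \<phi> t \<omega> ^ Suc n / fact (Suc n))"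
proof -
  let ?A = "\<lambda>s::real. LBINT r=0..s. \<phi> (B r \<omega>)"
  have A': "(?A has_real_derivative \<phi> (B s \<omega>)) (at s)" for s
    by (rule interval_integral_has_derivative[OF continuous_along_path[OF cont]])
  have A_cont: "continuous_on UNIV ?A"
    using A' DERIV_isCont by (intro continuous_at_imp_continuous_on) blast
  have "(\<integral>\<^sup>+ s. indicator {0<..<t} s * ennreal (\<phi> (B s \<omega>)) * ennreal (occupation \<phi> s \<omega> ^ n / fact n) \<partial>lborel)
     = (\<integral>\<^sup>+ s. ennreal (\<phi> (B s \<omega>) * (?A s ^ n / fact n)) * indicator {0..t} s \<partial>lborel)"
  proof (rule nn_integral_cong_AE)
    show "AE s in lborel. indicator {0<..<t} s * ennreal (\<phi> (B s \<omega>)) * ennreal (occupation \<phi> s \<omega> ^ n / fact n)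
        = ennreal (\<phi> (B s \<omega>) * (?A s ^ n / fact n)) * indicator {0..t} s"
      using AE_lborel_singleton[of 0] AE_lborel_singleton[of t]
      by eventually_elim (auto simp: indicator_def occupation_interval[symmetric] ennreal_mult'[symmetric] nonneg)
  qed
  also have "\<dots> = ennreal (?A t ^ Suc n / fact (Suc n) - ?A 0 ^ Suc n / fact (Suc n))"
  proof (rule nn_integral_FTC_Icc)
    show "(\<lambda>s. \<phi> (B s \<omega>) * (?A s ^ n / fact n)) \<in> borel_measurable borel"
      by (intro borel_measurable_continuous_onI continuous_intros A_cont continuous_along_path[OF cont]) auto
    fix s assume s: "s \<in> {0..t}"
    show "0 \<le> \<phi> (B s \<omega>) * (?A s ^ n / fact n)"
      using s by (simp add: nonneg occupation_interval[symmetric] occupation_nonneg)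
    show "DERIV (\<lambda>s. ?A s ^ Suc n / fact (Suc n)) s :> \<phi> (B s \<omega>) * (?A s ^ n / fact n)"
    proof -
      have "(1 + real n) * (x * y) / fact (Suc n) = x * (y / fact n)" for x y :: real
      proof -
        have "(1 + real n) * (x * y) / fact (Suc n) = real (Suc n) * (x * y) / (real (Suc n) * fact n)"
          by (simp only: fact_Suc of_nat_Suc of_nat_mult)
        then show ?thesis by (simp del: of_nat_Suc)
      qed
      then show ?thesis
        using DERIV_cdivide[OF DERIV_power_Suc[OF A'[of s], of n], of "fact (Suc n)"] by (simp only:)
    qed
  qed (use t in auto)
  also have "?A 0 = 0" by (simp add: zero_ereal_def)
  finally show ?thesis using t by (simp add: occupation_interval)
qed

text \<open>
  Riemann sums approximate the occupation time, and \<open>nn_integral_increment_grid\<close> applies to each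
  of them.  The bounds on \<open>f\<close>, \<open>g\<close> and \<open>\<phi>\<close> allow dominated convergence on both sides.
\<close>

lemma markov_occupation:
  assumes cont: "continuous_on UNIV \<phi>" and nonneg: "\<And>x. 0 \<le> \<phi> x" and bdd: "\<And>x. \<phi> x \<le> c"
    and st: "0 < s" "s < t"
    and f [measurable]: "f \<in> borel_measurable borel" "\<And>x. f x \<le> C" "C < top"
    and g [measurable]: "g \<in> borel_measurable borel" "\<And>x. g x \<le> D" "D < top"
  shows "(\<integral>\<^sup>+ \<omega>. f (B t \<omega>) * g (B s \<omega>) * ennreal (occupation \<phi> s \<omega> ^ n / fact n) \<partial>M)
    = (\<integral>\<^sup>+ \<omega>. heat_semigroup (t - s) f (B s \<omega>) * g (B s \<omega>) * ennreal (occupation \<phi> s \<omega> ^ n / fact n) \<partial>M)"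
proof -
  have [measurable]: "\<phi> \<in> borel_measurable borel" by (rule borel_measurable_continuous_onI[OF cont])
  define R where "R = (\<lambda>N \<omega>. s / real (Suc N) * (\<Sum>k<Suc N. \<phi> (B (real k * s / real (Suc N)) \<omega>)))"
  have [measurable]: "R N \<in> borel_measurable M" for N unfolding R_def by measurable
  have R_nonneg: "0 \<le> R N \<omega>" for N \<omega>
    unfolding R_def using st nonneg by (intro mult_nonneg_nonneg sum_nonneg) auto
  have R_bound: "R N \<omega> \<le> s * c" for N \<omega>
  proof -
    have "R N \<omega> \<le> s / real (Suc N) * (\<Sum>k<Suc N. c)"
      unfolding R_def using st bdd by (intro mult_left_mono sum_mono) auto
    also have "\<dots> = s * c" by (simp del: of_nat_Suc)
    finally show ?thesis .
  qed
  have R_lim: "(\<lambda>N. R N \<omega>) \<longlonglongrightarrow> occupation \<phi> s \<omega>" for \<omega>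
    unfolding R_def using st riemann_sum_tendsto_integral[OF continuous_along_path[OF cont] st(1), of \<omega>]
    by (simp add: occupation_interval)
  have step: "(\<integral>\<^sup>+ \<omega>. f (B t \<omega>) * g (B s \<omega>) * ennreal (R N \<omega> ^ n / fact n) \<partial>M)
     = (\<integral>\<^sup>+ \<omega>. heat_semigroup (t - s) f (B s \<omega>) * g (B s \<omega>) * ennreal (R N \<omega> ^ n / fact n) \<partial>M)" for N
  proof -
    let ?F = "\<lambda>x y z. f (y + x) * g y * ennreal (z ^ n / fact n)"
    have "(\<integral>\<^sup>+ \<omega>. f (B t \<omega>) * g (B s \<omega>) * ennreal (R N \<omega> ^ n / fact n) \<partial>M)
      = (\<integral>\<^sup>+ \<omega>. ?F (B t \<omega> - B s \<omega>) (B s \<omega>) (R N \<omega>) \<partial>M)" by simp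
    also have "\<dots> = (\<integral>\<^sup>+ \<omega>. (\<integral>\<^sup>+ x. ?F x (B s \<omega>) (R N \<omega>) \<partial>distr M borel (\<lambda>\<omega>. B t \<omega> - B s \<omega>)) \<partial>M)"
      unfolding R_def by (rule nn_integral_increment_grid[where F="?F"]) (use st in \<open>auto simp: split_beta\<close>)
    also have "\<dots> = (\<integral>\<^sup>+ \<omega>. heat_semigroup (t - s) f (B s \<omega>) * g (B s \<omega>) * ennreal (R N \<omega> ^ n / fact n) \<partial>M)"
    proof (intro nn_integral_cong)
      fix \<omega>
      have "(\<integral>\<^sup>+ x. ?F x (B s \<omega>) (R N \<omega>) \<partial>distr M borel (\<lambda>\<omega>. B t \<omega> - B s \<omega>)) = 
        (\<integral>\<^sup>+ x. (f (B s \<omega> + x) * ennreal (heat_kernel (t - s) x)) * (g (B s \<omega>) * ennreal (R N \<omega> ^ n / fact n)) \<partial>lborel)"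
        using st by (subst distr_increment) (auto simp: nn_integral_density mult_ac)
      also have "\<dots> = heat_semigroup (t - s) f (B s \<omega>) * (g (B s \<omega>) * ennreal (R N \<omega> ^ n / fact n))"
        by (simp add: nn_integral_multc heat_semigroup_translate)
      finally show "(\<integral>\<^sup>+ x. ?F x (B s \<omega>) (R N \<omega>) \<partial>distr M borel (\<lambda>\<omega>. B t \<omega> - B s \<omega>)) = 
         heat_semigroup (t - s) f (B s \<omega>) * g (B s \<omega>) * ennreal (R N \<omega> ^ n / fact n)"
        by (simp add: mult.assoc)
    qed
    finally show ?thesis .
  qed
  have lim: "(\<lambda>N. \<integral>\<^sup>+ \<omega>. h \<omega> * g (B s \<omega>) * ennreal (R N \<omega> ^ n / fact n) \<partial>M) \<longlonglongrightarrow> 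
     (\<integral>\<^sup>+ \<omega>. h \<omega> * g (B s \<omega>) * ennreal (occupation \<phi> s \<omega> ^ n / fact n) \<partial>M)"
    if h [measurable]: "h \<in> borel_measurable M" and hC: "\<And>\<omega>. h \<omega> \<le> C" for h
  proof (rule nn_integral_dominated_convergence[where w="\<lambda>_. C * D * ennreal ((s * c) ^ n / fact n)"])
    show "AE \<omega> in M. h \<omega> * g (B s \<omega>) * ennreal (R j \<omega> ^ n / fact n) \<le> C * D * ennreal ((s * c) ^ n / fact n)" for j
      by (intro AE_I2 mult_mono ennreal_leI divide_right_mono power_mono R_bound R_nonneg hC g) auto
    show "(\<integral>\<^sup>+ \<omega>. C * D * ennreal ((s * c) ^ n / fact n) \<partial>M) < \<infinity>"
      using f(3) g(3) by (simp add: emeasure_space_1 ennreal_mult_less_top)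
    show "AE \<omega> in M. (\<lambda>N. h \<omega> * g (B s \<omega>) * ennreal (R N \<omega> ^ n / fact n)) \<longlonglongrightarrow> h \<omega> * g (B s \<omega>) * ennreal (occupation \<phi> s \<omega> ^ n / fact n)"
    proof (intro AE_I2 ennreal_tendsto_cmult tendsto_ennrealI tendsto_intros R_lim)
      fix \<omega>
      have "h \<omega> < top" "g (B s \<omega>) < top" using hC[of \<omega>] g(2)[of "B s \<omega>"] f(3) g(3) by (auto intro: le_less_trans)
      then show "h \<omega> * g (B s \<omega>) < top" by (simp add: ennreal_mult_less_top)
    qed auto
  qed measurable
  show ?thesis
  proof (rule LIMSEQ_unique)
    show "(\<lambda>N. \<integral>\<^sup>+ \<omega>. f (B t \<omega>) * g (B s \<omega>) * ennreal (R N \<omega> ^ n / fact n) \<partial>M) \<longlonglongrightarrow> 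
     (\<integral>\<^sup>+ \<omega>. f (B t \<omega>) * g (B s \<omega>) * ennreal (occupation \<phi> s \<omega> ^ n / fact n) \<partial>M)"
      by (rule lim) (use f in auto)
    show "(\<lambda>N. \<integral>\<^sup>+ \<omega>. f (B t \<omega>) * g (B s \<omega>) * ennreal (R N \<omega> ^ n / fact n) \<partial>M) \<longlonglongrightarrow> 
     (\<integral>\<^sup>+ \<omega>. heat_semigroup (t - s) f (B s \<omega>) * g (B s \<omega>) * ennreal (occupation \<phi> s \<omega> ^ n / fact n) \<partial>M)"
      unfolding step by (rule lim) (use f st in \<open>auto intro: heat_semigroup_bound\<close>)
  qed
qed

text \<open>
  Conditioning on the path up to the last visit at time \<open>s\<close> replaces \<open>f(B\<^sub>t)\<close> by a function of
  \<open>B\<^sub>s\<close>, to which the induction hypothesis applies.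
\<close>

lemma occupation_moments:
  assumes cont: "continuous_on UNIV \<phi>" and nonneg: "\<And>x. 0 \<le> \<phi> x" and bdd: "\<And>x. \<phi> x \<le> c"
  shows "0 < t \<Longrightarrow> f \<in> borel_measurable borel \<Longrightarrow> (\<And>x. f x \<le> C) \<Longrightarrow> C < top \<Longrightarrow>
    (\<integral>\<^sup>+ \<omega>. f (B t \<omega>) * ennreal (occupation \<phi> t \<omega> ^ n / fact n) \<partial>M) = (\<integral>\<^sup>+ y. f y * visit_kernel \<phi> n t y \<partial>lborel)"
proof (induction n arbitrary: t f C)
  case 0
  note [measurable] = 0(2)
  have "(\<integral>\<^sup>+ \<omega>. f (B t \<omega>) \<partial>M) = (\<integral>\<^sup>+ y. f y \<partial>distr M borel (B t))"
    by (simp add: nn_integral_distr)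
  also have "\<dots> = (\<integral>\<^sup>+ y. f y * ennreal (heat_kernel t y) \<partial>lborel)"
    using 0 by (simp add: distr_position nn_integral_density mult.commute)
  finally show ?case by simp
next
  case (Suc n)
  have m\<phi> [measurable]: "\<phi> \<in> borel_measurable borel" by (rule borel_measurable_continuous_onI[OF cont])
  note [measurable] = Suc.prems(2) measurable_visit_kernel[OF m\<phi>]
  interpret LM: pair_sigma_finite lborel M ..
  let ?I = "\<lambda>s::real. indicator {0<..<t} s :: ennreal"
  have "(\<integral>\<^sup>+ \<omega>. f (B t \<omega>) * ennreal (occupation \<phi> t \<omega> ^ Suc n / fact (Suc n)) \<partial>M) = 
     (\<integral>\<^sup>+ \<omega>. (\<integral>\<^sup>+ s. ?I s * (f (B t \<omega>) * ennreal (\<phi> (B s \<omega>)) * ennreal (occupation \<phi> s \<omega> ^ n / fact n)) \<partial>lborel) \<partial>M)"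
  proof (intro nn_integral_cong)
    fix \<omega> assume [simp]: "\<omega> \<in> space M"
    show "f (B t \<omega>) * ennreal (occupation \<phi> t \<omega> ^ Suc n / fact (Suc n)) =
      (\<integral>\<^sup>+ s. ?I s * (f (B t \<omega>) * ennreal (\<phi> (B s \<omega>)) * ennreal (occupation \<phi> s \<omega> ^ n / fact n)) \<partial>lborel)"
      unfolding occupation_power[OF cont nonneg Suc.prems(1), symmetric]
      by (subst nn_integral_cmult[symmetric]) (simp_all add: mult_ac)
  qed
  also have "\<dots> = (\<integral>\<^sup>+ s. (\<integral>\<^sup>+ \<omega>. ?I s * (f (B t \<omega>) * ennreal (\<phi> (B s \<omega>)) * ennreal (occupation \<phi> s \<omega> ^ n / fact n)) \<partial>M) \<partial>lborel)"
    by (rule LM.Fubini') simp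
  also have "\<dots> = (\<integral>\<^sup>+ s. ?I s * (\<integral>\<^sup>+ x. (heat_semigroup (t - s) f x * ennreal (\<phi> x)) * visit_kernel \<phi> n s x \<partial>lborel) \<partial>lborel)"
  proof (intro nn_integral_cong)
    fix s :: real
    show "(\<integral>\<^sup>+ \<omega>. ?I s * (f (B t \<omega>) * ennreal (\<phi> (B s \<omega>)) * ennreal (occupation \<phi> s \<omega> ^ n / fact n)) \<partial>M) =
      ?I s * (\<integral>\<^sup>+ x. (heat_semigroup (t - s) f x * ennreal (\<phi> x)) * visit_kernel \<phi> n s x \<partial>lborel)"
    proof (cases "0 < s \<and> s < t")
      case True
      have "(\<integral>\<^sup>+ \<omega>. f (B t \<omega>) * ennreal (\<phi> (B s \<omega>)) * ennreal (occupation \<phi> s \<omega> ^ n / fact n) \<partial>M)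
        = (\<integral>\<^sup>+ \<omega>. heat_semigroup (t - s) f (B s \<omega>) * ennreal (\<phi> (B s \<omega>)) * ennreal (occupation \<phi> s \<omega> ^ n / fact n) \<partial>M)"
        using True Suc.prems
        by (intro markov_occupation[OF cont nonneg bdd, where D="ennreal c" and C=C])
           (auto intro: ennreal_leI bdd)
      also have "\<dots> = (\<integral>\<^sup>+ x. (heat_semigroup (t - s) f x * ennreal (\<phi> x)) * visit_kernel \<phi> n s x \<partial>lborel)"
      proof (rule Suc.IH)
        show "heat_semigroup (t - s) f x * ennreal (\<phi> x) \<le> C * ennreal c" for x
          using True Suc.prems by (intro mult_mono heat_semigroup_bound ennreal_leI bdd) auto
        show "C * ennreal c < top" using Suc.prems by (simp add: ennreal_mult_less_top)
      qed (use True in auto)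
      finally show ?thesis using True by simp
    qed (auto simp: indicator_def)
  qed
  also have "\<dots> = (\<integral>\<^sup>+ s. (\<integral>\<^sup>+ x. (\<integral>\<^sup>+ y. f y * (?I s * (visit_kernel \<phi> n s x * ennreal (\<phi> x) * ennreal (heat_kernel (t - s) (y - x)))) \<partial>lborel) \<partial>lborel) \<partial>lborel)"
    unfolding heat_semigroup_def
    by (simp add: nn_integral_cmult[symmetric] nn_integral_multc[symmetric] mult_ac)
  also have "\<dots> = (\<integral>\<^sup>+ s. (\<integral>\<^sup>+ y. (\<integral>\<^sup>+ x. f y * (?I s * (visit_kernel \<phi> n s x * ennreal (\<phi> x) * ennreal (heat_kernel (t - s) (y - x)))) \<partial>lborel) \<partial>lborel) \<partial>lborel)"
    by (intro nn_integral_cong lborel_pair.Fubini') simp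
  also have "\<dots> = (\<integral>\<^sup>+ y. (\<integral>\<^sup>+ s. (\<integral>\<^sup>+ x. f y * (?I s * (visit_kernel \<phi> n s x * ennreal (\<phi> x) * ennreal (heat_kernel (t - s) (y - x)))) \<partial>lborel) \<partial>lborel) \<partial>lborel)"
    by (rule lborel_pair.Fubini') simp
  also have "\<dots> = (\<integral>\<^sup>+ y. f y * visit_kernel \<phi> (Suc n) t y \<partial>lborel)"
    by (simp add: nn_integral_cmult)
  finally show ?case .
qed

end

section \<open>Characteristic functions and moments\<close>

text \<open>
  The exponential series is integrated term by term.
\<close>

lemma exp_moment_series:
  fixes g :: "'a \<Rightarrow> real" and m :: "nat \<Rightarrow> real"
  assumes [measurable]: "g \<in> borel_measurable \<mu>" and g: "\<And>x. 0 \<le> g x"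
    and mom: "\<And>n. (\<integral>\<^sup>+ x. ennreal (g x ^ n / fact n) \<partial>\<mu>) = ennreal (m n)" and m: "\<And>n. 0 \<le> m n"
    and sm: "summable (\<lambda>n. \<bar>\<eta>\<bar> ^ n * m n)"
  shows "(\<lambda>n. (\<i> * of_real \<eta>) ^ n * of_real (m n)) sums (\<integral>x. iexp (\<eta> * g x) \<partial>\<mu>)"
proof -
  let ?f = "\<lambda>n x. (\<i> * of_real \<eta>) ^ n * complex_of_real (g x ^ n / fact n)"
  have int_g: "integrable \<mu> (\<lambda>x. g x ^ n / fact n)" "(\<integral>x. g x ^ n / fact n \<partial>\<mu>) = m n" for n
  proof -
    show "integrable \<mu> (\<lambda>x. g x ^ n / fact n)"
      by (rule integrableI_nonneg) (use mom[of n] g in auto)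
    show "(\<integral>x. g x ^ n / fact n \<partial>\<mu>) = m n"
      by (rule integral_eq_nn_integral[THEN trans]) (use mom[of n] g m in auto)
  qed
  have norm_f: "norm (?f n x) = \<bar>\<eta>\<bar> ^ n * (g x ^ n / fact n)" for n x
    using g by (simp add: norm_mult norm_power norm_divide del: of_real_divide of_real_power)
  have pointwise: "(\<lambda>n. ?f n x) sums iexp (\<eta> * g x)" for x
  proof -
    have "(\<lambda>n. (\<i> * of_real (\<eta> * g x)) ^ n /\<^sub>R fact n) sums iexp (\<eta> * g x)"
      by (rule exp_converges)
    moreover have "(\<i> * of_real (\<eta> * g x)) ^ n /\<^sub>R fact n = ?f n x" for n
      by (simp add: power_mult_distrib scaleR_conv_of_real field_simps)
    ultimately show ?thesis by simp
  qed
  have "(\<lambda>n. integral\<^sup>L \<mu> (?f n)) sums (\<integral>x. (\<Sum>n. ?f n x) \<partial>\<mu>)"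
  proof (rule sums_integral)
    show "integrable \<mu> (?f n)" for n
      by (intro integrable_mult_right integrable_of_real int_g)
    show "AE x in \<mu>. summable (\<lambda>n. norm (?f n x))"
    proof (rule AE_I2)
      fix x
      have "summable (\<lambda>n. (\<bar>\<eta>\<bar> * g x) ^ n /\<^sub>R fact n)" by (rule summable_exp_generic)
      moreover have "norm (?f n x) = (\<bar>\<eta>\<bar> * g x) ^ n /\<^sub>R fact n" for n
        unfolding norm_f by (simp add: power_mult_distrib field_simps)
      ultimately show "summable (\<lambda>n. norm (?f n x))" by simp
    qed
    show "summable (\<lambda>n. \<integral>x. norm (?f n x) \<partial>\<mu>)"
      unfolding norm_f using sm by (simp only: integral_mult_right_zero int_g(2))
  qed
  moreover have "(\<Sum>n. ?f n x) = iexp (\<eta> * g x)" for x using sums_unique[OF pointwise] by simp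
  moreover have "integral\<^sup>L \<mu> (?f n) = (\<i> * of_real \<eta>) ^ n * of_real (m n)" for n
    by (simp only: integral_mult_right_zero integral_of_real int_g)
  ultimately show ?thesis by simp
qed

text \<open>
  Levy's uniqueness theorem without normalization; the total mass is the value of the
  characteristic function at \<open>0\<close>.
\<close>

lemma finite_measure_eqI_char:
  fixes \<mu> \<nu> :: "real measure"
  assumes fin: "finite_measure \<mu>" "finite_measure \<nu>" and sets [simp]: "sets \<mu> = sets borel" "sets \<nu> = sets borel"
    and char: "\<And>\<eta>. (\<integral>x. iexp (\<eta> * x) \<partial>\<mu>) = (\<integral>x. iexp (\<eta> * x) \<partial>\<nu>)"
  shows "\<mu> = \<nu>"
proof -
  interpret \<mu>: finite_measure \<mu> by fact
  interpret \<nu>: finite_measure \<nu> by fact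
  have sp: "space \<mu> = UNIV" "space \<nu> = UNIV" using sets[THEN sets_eq_imp_space_eq] by auto
  have mass: "measure \<mu> UNIV = measure \<nu> UNIV"
    using char[of 0] by (simp add: sp)
  then have emass: "emeasure \<mu> UNIV = emeasure \<nu> UNIV" by (simp add: \<mu>.emeasure_eq_measure \<nu>.emeasure_eq_measure)
  show ?thesis
  proof (cases "measure \<mu> UNIV = 0")
    case True
    then have z: "emeasure \<mu> UNIV = 0" "emeasure \<nu> UNIV = 0"
      using emass by (simp_all add: \<mu>.emeasure_eq_measure)
    show ?thesis
    proof (rule measure_eqI)
      fix X assume "X \<in> sets \<mu>"
      then show "emeasure \<mu> X = emeasure \<nu> X"
        using emeasure_mono[of X UNIV \<mu>] emeasure_mono[of X UNIV \<nu>] z by simp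
    qed simp
  next
    case False
    define c where "c = 1 / measure \<mu> UNIV"
    have c: "c > 0" using False by (simp add: c_def zero_less_measure_iff)
    have meas: "(\<lambda>_. c) \<in> borel_measurable \<mu>" "(\<lambda>_. c) \<in> borel_measurable \<nu>" by auto
    have rd: "real_distribution (density \<kappa> (\<lambda>_. ennreal c))" 
      if "finite_measure \<kappa>" "sets \<kappa> = sets borel" "measure \<kappa> UNIV = measure \<mu> UNIV" for \<kappa>
    proof -
      interpret \<kappa>: finite_measure \<kappa> by fact
      have "space \<kappa> = UNIV" using that(2)[THEN sets_eq_imp_space_eq] by simp
      then have "emeasure (density \<kappa> (\<lambda>_. ennreal c)) UNIV = 1"
        using that False c by (simp add: emeasure_density_const \<kappa>.emeasure_eq_measure c_def ennreal_mult'[symmetric])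
      then show ?thesis
        using that \<open>space \<kappa> = UNIV\<close> by (simp add: real_distribution_def real_distribution_axioms_def prob_spaceI)
    qed
    have "density \<mu> (\<lambda>_. ennreal c) = density \<nu> (\<lambda>_. ennreal c)"
    proof (rule Levy_uniqueness)
      show "real_distribution (density \<mu> (\<lambda>_. ennreal c))" "real_distribution (density \<nu> (\<lambda>_. ennreal c))"
        using fin mass by (auto intro: rd)
      have scale: "(\<integral>x. iexp (\<eta> * x) \<partial>density \<kappa> (\<lambda>_. ennreal c)) = c *\<^sub>R (\<integral>x. iexp (\<eta> * x) \<partial>\<kappa>)"
        if sets_\<kappa>: "sets \<kappa> = sets borel" for \<kappa> \<eta>
      proof -
        have "(\<lambda>x. iexp (\<eta> * x)) \<in> borel_measurable \<kappa>"
          unfolding measurable_cong_sets[OF sets_\<kappa> refl] by measurable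
        then show ?thesis using c by (subst integral_density) auto
      qed
      show "char (density \<mu> (\<lambda>_. ennreal c)) = char (density \<nu> (\<lambda>_. ennreal c))"
        unfolding char_def fun_eq_iff by (simp only: scale sets char simp_thms)
    qed
    then have "ennreal c * emeasure \<mu> X = ennreal c * emeasure \<nu> X" if "X \<in> sets borel" for X
      using that emeasure_density_const[of X \<mu> "ennreal c"] emeasure_density_const[of X \<nu> "ennreal c"] by simp
    then have "emeasure \<mu> X = emeasure \<nu> X" if "X \<in> sets borel" for X
      using that c ennreal_mult_cancel_left[of "ennreal c"] by fastforce
    then show ?thesis by (intro measure_eqI) auto
  qed
qed

lemma emeasure_distr_rectangle:
  assumes [measurable]: "X \<in> borel_measurable P" "Y \<in> borel_measurable P" "A \<in> sets borel" "C \<in> sets borel"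
  shows "emeasure (distr P (borel \<Otimes>\<^sub>M borel) (\<lambda>\<omega>. (X \<omega>, Y \<omega>))) (A \<times> C)
    = emeasure (distr (density P (\<lambda>\<omega>. indicator A (X \<omega>))) borel Y) C"
proof -
  have "emeasure (distr P (borel \<Otimes>\<^sub>M borel) (\<lambda>\<omega>. (X \<omega>, Y \<omega>))) (A \<times> C)
      = emeasure P ((\<lambda>\<omega>. (X \<omega>, Y \<omega>)) -` (A \<times> C) \<inter> space P)"
    by (rule emeasure_distr) auto
  also have "\<dots> = (\<integral>\<^sup>+ \<omega>. indicator ((\<lambda>\<omega>. (X \<omega>, Y \<omega>)) -` (A \<times> C) \<inter> space P) \<omega> \<partial>P)"
    by (rule nn_integral_indicator[symmetric]) measurable
  also have "\<dots> = (\<integral>\<^sup>+ \<omega>. indicator A (X \<omega>) * indicator (Y -` C \<inter> space P) \<omega> \<partial>P)"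
    by (intro nn_integral_cong) (auto simp: indicator_def)
  also have "\<dots> = emeasure (density P (\<lambda>\<omega>. indicator A (X \<omega>))) (Y -` C \<inter> space P)"
    by (rule emeasure_density[symmetric]) measurable
  also have "\<dots> = emeasure (distr (density P (\<lambda>\<omega>. indicator A (X \<omega>))) borel Y) C"
    by (subst emeasure_distr) auto
  finally show ?thesis .
qed

text \<open>
  For fixed \<open>A\<close>, the characteristic functions determine the law of \<open>Y\<close> on the event
  \<open>X \<in> A\<close>, hence the joint law on rectangles.
\<close>

lemma joint_distr_eqI_char:
  fixes X Y :: "'a \<Rightarrow> real" and X' Y' :: "'b \<Rightarrow> real"
  assumes P: "finite_measure P" and Q: "finite_measure Q"
    and m [measurable]: "X \<in> borel_measurable P" "Y \<in> borel_measurable P" "X' \<in> borel_measurable Q" "Y' \<in> borel_measurable Q"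
    and char: "\<And>A \<eta>. A \<in> sets borel \<Longrightarrow>
      (\<integral>\<omega>. iexp (\<eta> * Y \<omega>) \<partial>density P (\<lambda>\<omega>. indicator A (X \<omega>))) = (\<integral>\<omega>. iexp (\<eta> * Y' \<omega>) \<partial>density Q (\<lambda>\<omega>. indicator A (X' \<omega>)))"
  shows "distr P (borel \<Otimes>\<^sub>M borel) (\<lambda>\<omega>. (X \<omega>, Y \<omega>)) = distr Q (borel \<Otimes>\<^sub>M borel) (\<lambda>\<omega>. (X' \<omega>, Y' \<omega>))"
proof -
  have fin: "finite_measure (distr (density R (\<lambda>\<omega>. indicator A (U \<omega>))) borel V)"
    if "finite_measure R" and [measurable]: "U \<in> borel_measurable R" "V \<in> borel_measurable R" "A \<in> sets borel"
    for R :: "'c measure" and U V :: "'c \<Rightarrow> real" and A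
  proof (rule finite_measure.finite_measure_distr)
    interpret R: finite_measure R by fact
    show "finite_measure (density R (\<lambda>\<omega>. indicator A (U \<omega>)))"
    proof (rule finite_measureI)
      have "emeasure (density R (\<lambda>\<omega>. indicator A (U \<omega>))) (space R) = (\<integral>\<^sup>+ \<omega>. indicator A (U \<omega>) * indicator (space R) \<omega> \<partial>R)"
        by (rule emeasure_density) measurable
      also have "\<dots> \<le> (\<integral>\<^sup>+ \<omega>. 1 \<partial>R)" by (intro nn_integral_mono) (auto simp: indicator_def)
      also have "\<dots> < \<infinity>" by (simp add: R.emeasure_finite less_top[symmetric])
      finally show "emeasure (density R (\<lambda>\<omega>. indicator A (U \<omega>))) (space (density R (\<lambda>\<omega>. indicator A (U \<omega>)))) \<noteq> \<infinity>"
        by simp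
    qed
  qed simp
  have eq: "distr (density P (\<lambda>\<omega>. indicator A (X \<omega>))) borel Y = distr (density Q (\<lambda>\<omega>. indicator A (X' \<omega>))) borel Y'"
    if [measurable]: "A \<in> sets borel" for A
  proof (rule finite_measure_eqI_char)
    fix \<eta> :: real
    show "(\<integral>x. iexp (\<eta> * x) \<partial>distr (density P (\<lambda>\<omega>. indicator A (X \<omega>))) borel Y) =
      (\<integral>x. iexp (\<eta> * x) \<partial>distr (density Q (\<lambda>\<omega>. indicator A (X' \<omega>))) borel Y')"
      using char[OF that, of \<eta>] by (simp add: integral_distr)
  qed (auto intro!: fin P Q)
  let ?E = "{A \<times> C | A C. A \<in> sets (borel :: real measure) \<and> C \<in> sets (borel :: real measure)}"
  interpret P: finite_measure P by fact
  show ?thesis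
  proof (rule measure_eqI_generator_eq[where E="?E" and \<Omega>=UNIV and A="\<lambda>_. UNIV"])
    show "Int_stable ?E" by (rule Int_stable_pair_measure_generator)
    show "range (\<lambda>_::nat. UNIV) \<subseteq> ?E" by (auto intro!: exI[of _ UNIV])
    show "emeasure (distr P (borel \<Otimes>\<^sub>M borel) (\<lambda>\<omega>. (X \<omega>, Y \<omega>))) UNIV \<noteq> \<infinity>"
    proof -
      have "UNIV \<in> sets (borel \<Otimes>\<^sub>M borel :: (real \<times> real) measure)" unfolding borel_prod by simp
      then show ?thesis by (subst emeasure_distr) (auto simp: P.emeasure_finite)
    qed
    fix R assume "R \<in> ?E"
    then show "emeasure (distr P (borel \<Otimes>\<^sub>M borel) (\<lambda>\<omega>. (X \<omega>, Y \<omega>))) R = emeasure (distr Q (borel \<Otimes>\<^sub>M borel) (\<lambda>\<omega>. (X' \<omega>, Y' \<omega>))) R"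
      by (auto simp: emeasure_distr_rectangle m eq)
  qed (simp_all add: sets_pair_measure)
qed

section \<open>The characteristic function of the smoothed local time\<close>

text \<open>
  For each bump the characteristic function is the series of its moments.  The moments converge by
  \<open>visit_moment_tendsto\<close>, and Tannery's theorem passes to the limit in the series.
\<close>

lemma (in continuous_brownian_motion) char_occupation_tendsto:
  fixes t a \<eta> :: real
  assumes t: "0 < t" and A [measurable]: "A \<in> sets borel"
    and cont: "\<And>k. continuous_on UNIV (\<phi> k)" and bdd: "\<And>k x. \<phi> k x \<le> c k"
    and \<phi>: "\<And>k. bump (\<phi> k) a (\<epsilon> k)" and \<epsilon>: "\<epsilon> \<longlonglongrightarrow> 0" "\<And>k. \<epsilon> k \<le> 1 / 2"
  obtains m where
    "\<And>n. 0 \<le> m n" "\<And>n. (\<integral>\<^sup>+ y. indicator A y * limit_kernel a n t y \<partial>lborel) = ennreal (m n)"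
    "summable (\<lambda>n. \<bar>\<eta>\<bar> ^ n * m n)"
    "(\<lambda>k. \<integral>\<omega>. iexp (\<eta> * occupation (\<phi> k) t \<omega>) \<partial>density M (\<lambda>\<omega>. indicator A (B t \<omega>))) 
       \<longlonglongrightarrow> (\<Sum>n. (\<i> * of_real \<eta>) ^ n * of_real (m n))"
proof -
  have [measurable]: "\<phi> k \<in> borel_measurable borel" for k using \<phi>[of k] by (simp add: bump_def)
  have nonneg: "0 \<le> \<phi> k x" for k x using \<phi>[of k] by (simp add: bump_def)
  let ?I = "\<lambda>k n. \<integral>\<^sup>+ y. indicator A y * visit_kernel (\<phi> k) n t y \<partial>lborel"
  let ?J = "\<lambda>n. \<integral>\<^sup>+ y. indicator A y * limit_kernel a n t y \<partial>lborel"
  \<comment> \<open>Rough bounds, enough for the moments and their limits to be finite.\<close>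
  define c0 where "c0 = exp (1\<^sup>2 * t / 2) / sqrt (2 * pi * t)"
  have I_le: "?I k n \<le> ennreal (max 1 (c0 * (exp 1 / 1) ^ n * (2 / 1)))" for k n
  proof (cases n)
    case 0
    have "?I k 0 \<le> (\<integral>\<^sup>+ y. ennreal (heat_kernel t y) \<partial>lborel)"
      by (intro nn_integral_mono) (auto simp: indicator_def)
    also have "\<dots> \<le> ennreal (max 1 (c0 * (exp 1 / 1) ^ n * (2 / 1)))"
      using t by (simp add: nn_integral_heat_kernel)
    finally show ?thesis by (simp only: 0)
  next
    case (Suc m)
    interpret bump "\<phi> k" a "\<epsilon> k" by (rule \<phi>)
    have "?I k (Suc m) \<le> ennreal (c0 * (exp 1 / 1) ^ Suc m * (2 / 1))"
      unfolding c0_def using \<epsilon>(2)[of k] by (intro visit_moment_bound t) auto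
    also have "\<dots> \<le> ennreal (max 1 (c0 * (exp 1 / 1) ^ Suc m * (2 / 1)))"
      by (intro ennreal_leI) auto
    finally show ?thesis by (simp only: Suc)
  qed
  have I_lim: "(\<lambda>k. ?I k n) \<longlonglongrightarrow> ?J n" for n
    by (rule visit_moment_tendsto[OF t \<phi> \<epsilon> A])
  have J_le: "?J n \<le> ennreal (max 1 (c0 * (exp 1 / 1) ^ n * (2 / 1)))" for n
    by (rule LIMSEQ_le_const2[OF I_lim]) (use I_le in auto)
  define m where "m = (\<lambda>n. enn2real (?J n))"
  define mk where "mk = (\<lambda>k n. enn2real (?I k n))"
  have m: "0 \<le> m n" "?J n = ennreal (m n)" for n
    unfolding m_def using J_le[of n] by (auto simp: ennreal_enn2real_if top_unique)
  have mk: "0 \<le> mk k n" "?I k n = ennreal (mk k n)" for k n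
    unfolding mk_def using I_le[of k n] by (auto simp: ennreal_enn2real_if top_unique)
  have mk_lim: "(\<lambda>k. mk k n) \<longlonglongrightarrow> m n" for n
    using I_lim[of n] unfolding m(2) mk(2) by (simp add: tendsto_ennreal_iff m mk)
  \<comment> \<open>With this rate, the geometric bound on the moments beats the factor \<open>\<bar>\<eta>\<bar>\<^sup>n\<close>: the ratio becomes
    at most \<open>1 / 2\<close>.\<close>
  define \<beta> where "\<beta> = 2 * exp 1 * (\<bar>\<eta>\<bar> + 1)"
  have \<beta>: "\<beta> > 0" by (simp add: \<beta>_def add_nonneg_pos)
  define C where "C = exp (\<beta>\<^sup>2 * t / 2) / sqrt (2 * pi * t) * (2 / \<beta>)"
  have C: "C \<ge> 0" using t \<beta> by (simp add: C_def)
  have ratio: "\<bar>\<eta>\<bar> * (exp 1 / \<beta>) \<le> 1 / 2" using \<beta> by (simp add: \<beta>_def field_simps)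
  have mk_bound: "\<bar>\<eta>\<bar> ^ Suc n * mk k (Suc n) \<le> C * (1 / 2) ^ Suc n" if k: "2 * \<beta> * \<epsilon> k \<le> 1" for k n
  proof -
    interpret bump "\<phi> k" a "\<epsilon> k" by (rule \<phi>)
    have "ennreal (mk k (Suc n)) \<le> ennreal (exp (\<beta>\<^sup>2 * t / 2) / sqrt (2 * pi * t) * (exp 1 / \<beta>) ^ Suc n * (2 / \<beta>))"
      unfolding mk(2)[symmetric] by (rule visit_moment_bound[OF t \<beta> k])
    also have "exp (\<beta>\<^sup>2 * t / 2) / sqrt (2 * pi * t) * (exp 1 / \<beta>) ^ Suc n * (2 / \<beta>) = C * (exp 1 / \<beta>) ^ Suc n"
      unfolding C_def by (simp only: mult_ac)
    finally have "mk k (Suc n) \<le> C * (exp 1 / \<beta>) ^ Suc n"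
      using C \<beta> by (subst (asm) ennreal_le_iff) (auto intro!: mult_nonneg_nonneg simp del: power_Suc)
    then have "\<bar>\<eta>\<bar> ^ Suc n * mk k (Suc n) \<le> \<bar>\<eta>\<bar> ^ Suc n * (C * (exp 1 / \<beta>) ^ Suc n)"
      by (intro mult_left_mono) auto
    also have "\<dots> = C * (\<bar>\<eta>\<bar> * (exp 1 / \<beta>)) ^ Suc n" by (simp only: power_mult_distrib mult_ac)
    also have "\<dots> \<le> C * (1 / 2) ^ Suc n"
      using \<beta> by (intro mult_left_mono power_mono ratio C) auto
    finally show ?thesis .
  qed
  have small: "\<forall>\<^sub>F k in sequentially. 2 * \<beta> * \<epsilon> k \<le> 1"
  proof -
    have "(\<lambda>k. 2 * \<beta> * \<epsilon> k) \<longlonglongrightarrow> 2 * \<beta> * 0" by (intro tendsto_intros \<epsilon>)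
    then have "\<forall>\<^sub>F k in sequentially. 2 * \<beta> * \<epsilon> k < 1" by (rule order_tendstoD(2)) simp
    then show ?thesis by eventually_elim simp
  qed
  let ?a = "\<lambda>n k. (\<i> * of_real \<eta>) ^ n * complex_of_real (mk k n)"
  let ?b = "\<lambda>n. (\<i> * of_real \<eta>) ^ n * complex_of_real (m n)"
  have norm_a: "norm (?a n k) = \<bar>\<eta>\<bar> ^ n * mk k n" for n k
    using mk by (simp add: norm_mult norm_power)
  have norm_b: "norm (?b n) = \<bar>\<eta>\<bar> ^ n * m n" for n
    using m by (simp add: norm_mult norm_power)
  have tannery: "(\<forall>\<^sub>F k in sequentially. summable (\<lambda>n. norm (?a n k))) \<and>
     summable (\<lambda>n. norm (?b n)) \<and> ((\<lambda>k. \<Sum>n. ?a n k) \<longlongrightarrow> (\<Sum>n. ?b n)) sequentially"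
  proof (rule tannerys_theorem)
    show "((\<lambda>k. ?a n k) \<longlongrightarrow> ?b n) sequentially" for n
      by (intro tendsto_intros mk_lim)
    have "\<forall>\<^sub>F p in sequentially \<times>\<^sub>F sequentially. 1 \<le> fst p \<and> 2 * \<beta> * \<epsilon> (snd p) \<le> 1"
      using eventually_prodI[OF eventually_ge_at_top[of "1::nat"] small] .
    then show "\<forall>\<^sub>F (n, k) in sequentially \<times>\<^sub>F sequentially. norm (?a n k) \<le> C * (1 / 2) ^ n"
    proof eventually_elim
      case (elim p)
      then obtain n k where p: "p = (Suc n, k)" "2 * \<beta> * \<epsilon> k \<le> 1"
        by (cases p) (auto simp: Suc_le_eq gr0_conv_Suc)
      show ?case unfolding p(1) prod.case norm_a by (rule mk_bound[OF p(2)])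
    qed
    show "summable (\<lambda>n. C * (1 / 2) ^ n)"
      by (intro summable_mult summable_geometric) simp
  qed simp
  show ?thesis
  proof (rule that[of m])
    show "0 \<le> m n" "?J n = ennreal (m n)" for n by (rule m)+
    show "summable (\<lambda>n. \<bar>\<eta>\<bar> ^ n * m n)" using tannery[THEN conjunct2, THEN conjunct1] unfolding norm_b .
    have "\<forall>\<^sub>F k in sequentially. (\<Sum>n. ?a n k) = (\<integral>\<omega>. iexp (\<eta> * occupation (\<phi> k) t \<omega>) \<partial>density M (\<lambda>\<omega>. indicator A (B t \<omega>)))"
      using tannery[THEN conjunct1] 
    proof eventually_elim
      case (elim k)
      have "(\<lambda>n. ?a n k) sums (\<integral>\<omega>. iexp (\<eta> * occupation (\<phi> k) t \<omega>) \<partial>density M (\<lambda>\<omega>. indicator A (B t \<omega>)))"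
      proof (rule exp_moment_series)
        show "summable (\<lambda>n. \<bar>\<eta>\<bar> ^ n * mk k n)" using elim unfolding norm_a .
        show "(\<integral>\<^sup>+ \<omega>. ennreal (occupation (\<phi> k) t \<omega> ^ n / fact n) \<partial>density M (\<lambda>\<omega>. indicator A (B t \<omega>))) = ennreal (mk k n)" for n
        proof -
          have "(\<integral>\<^sup>+ \<omega>. ennreal (occupation (\<phi> k) t \<omega> ^ n / fact n) \<partial>density M (\<lambda>\<omega>. indicator A (B t \<omega>)))
            = (\<integral>\<^sup>+ \<omega>. indicator A (B t \<omega>) * ennreal (occupation (\<phi> k) t \<omega> ^ n / fact n) \<partial>M)"
            by (subst nn_integral_density) auto
          also have "\<dots> = ?I k n"
            by (rule occupation_moments[OF cont nonneg bdd t, where C=1]) (auto simp: indicator_def)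
          finally show ?thesis unfolding mk(2) .
        qed
      qed (auto intro: occupation_nonneg nonneg mk)
      then show ?case by (rule sums_unique[symmetric])
    qed
    from Lim_transform_eventually[OF tannery[THEN conjunct2, THEN conjunct2] this]
    show "(\<lambda>k. \<integral>\<omega>. iexp (\<eta> * occupation (\<phi> k) t \<omega>) \<partial>density M (\<lambda>\<omega>. indicator A (B t \<omega>))) \<longlonglongrightarrow> (\<Sum>n. ?b n)" .
  qed
qed

section \<open>A modification with continuous paths\<close>

lemma (in prob_space) indep_vars_cong_AE:
  assumes ind: "indep_vars M' X I" and I: "finite I"
    and eq: "\<And>i. i \<in> I \<Longrightarrow> AE \<omega> in M. X i \<omega> = Y i \<omega>"
    and Y: "\<And>i. i \<in> I \<Longrightarrow> random_variable (M' i) (Y i)"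
  shows "indep_vars M' Y I"
proof (cases "I = {}")
  case True
  then show ?thesis by (simp add: indep_vars_def indep_sets_def)
next
  case False
  have X: "random_variable (M' i) (X i)" if "i \<in> I" for i
    using ind that by (auto simp: indep_vars_def)
  have "AE \<omega> in M. \<forall>i\<in>I. X i \<omega> = Y i \<omega>"
    using I eq by (intro AE_finite_allI) auto
  then have ae: "AE \<omega> in M. (\<lambda>i\<in>I. Y i \<omega>) = (\<lambda>i\<in>I. X i \<omega>)"
    by eventually_elim (auto simp: restrict_def)
  have "distr M (PiM I M') (\<lambda>\<omega>. \<lambda>i\<in>I. Y i \<omega>) = distr M (PiM I M') (\<lambda>\<omega>. \<lambda>i\<in>I. X i \<omega>)"
    using ae X Y by (intro distr_cong_AE measurable_restrict) auto
  also have "\<dots> = PiM I (\<lambda>i. distr M (M' i) (X i))"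
    using ind indep_vars_iff_distr_eq_PiM'[OF False X] by simp
  also have "\<dots> = PiM I (\<lambda>i. distr M (M' i) (Y i))"
    using eq X Y by (intro PiM_cong distr_cong_AE) auto
  finally show ?thesis using indep_vars_iff_distr_eq_PiM'[OF False Y] by simp
qed

text \<open>
  The paths are replaced by \<open>0\<close> on a null set and are constant at negative times.  The increments
  change on null sets alone, hence keep their joint law.
\<close>

lemma (in standard_brownian_motion) continuous_modification:
  obtains X where "continuous_brownian_motion M X" "AE \<omega> in M. \<forall>s\<ge>0. X s \<omega> = B s \<omega>"
proof -
  have "AE \<omega> in M. B 0 \<omega> = 0 \<and> continuous_on {0..} (\<lambda>t. B t \<omega>)"
    using starts_at_0 continuous_paths by eventually_elim simp
  then obtain N where N: "{\<omega> \<in> space M. \<not> (B 0 \<omega> = 0 \<and> continuous_on {0..} (\<lambda>t. B t \<omega>))} \<subseteq> N"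
    "N \<in> sets M" "emeasure M N = 0"
    by (rule AE_E)
  define G where "G = space M - N"
  have G [measurable]: "G \<in> sets M" using N(2) by (auto simp: G_def)
  have good: "B 0 \<omega> = 0" "continuous_on {0..} (\<lambda>t. B t \<omega>)" if "\<omega> \<in> G" for \<omega>
    using that N(1) by (auto simp: G_def)
  define X where "X = (\<lambda>s \<omega>. if \<omega> \<in> G then B (max 0 s) \<omega> else 0)"
  have ae: "AE \<omega> in M. \<forall>s\<ge>0. X s \<omega> = B s \<omega>"
  proof (rule AE_I[OF _ N(3,2)])
    show "{\<omega> \<in> space M. \<not> (\<forall>s\<ge>0. X s \<omega> = B s \<omega>)} \<subseteq> N"
      by (auto simp: X_def G_def max_def)
  qed
  have meas [measurable]: "X s \<in> borel_measurable M" for s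
  proof -
    have [measurable]: "B (max 0 s) \<in> borel_measurable M" by (rule random_variable_B) simp
    show ?thesis unfolding X_def by (intro measurable_If_set) (use G in \<open>auto\<close>)
  qed
  have [measurable]: "0 \<le> s \<Longrightarrow> B s \<in> borel_measurable M" for s by (rule random_variable_B)
  have inc: "AE \<omega> in M. B t \<omega> - B s \<omega> = X t \<omega> - X s \<omega>" if "0 \<le> s" "0 \<le> t" for s t
    using ae by eventually_elim (use that in auto)
  have "continuous_brownian_motion M X"
  proof
    fix t :: real assume "0 \<le> t"
    show "random_variable borel (X t)" by (rule meas)
  next
    show "AE \<omega> in M. X 0 \<omega> = 0" using good by (auto simp: X_def)
  next
    fix \<tau> :: "nat \<Rightarrow> real" and n :: nat
    assume \<tau>: "0 \<le> \<tau> 0" "strict_mono_on {..n} \<tau>"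
    have pos: "0 \<le> \<tau> i" if "i \<le> n" for i
      using \<tau>(1) strict_mono_onD[OF \<tau>(2), of 0 i] that by (cases "i = 0") auto
    show "indep_vars (\<lambda>_. borel) (\<lambda>i \<omega>. X (\<tau> (Suc i)) \<omega> - X (\<tau> i) \<omega>) {..<n}"
    proof (rule indep_vars_cong_AE[OF independent_increments[OF \<tau>]])
      fix i assume "i \<in> {..<n}"
      then show "AE \<omega> in M. B (\<tau> (Suc i)) \<omega> - B (\<tau> i) \<omega> = X (\<tau> (Suc i)) \<omega> - X (\<tau> i) \<omega>"
        by (intro inc pos) auto
    qed auto
  next
    fix s t :: real assume st: "0 \<le> s" "s < t"
    have "distr M lborel (\<lambda>\<omega>. X t \<omega> - X s \<omega>) = distr M lborel (\<lambda>\<omega>. B t \<omega> - B s \<omega>)"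
      using inc[of s t] st by (intro distr_cong_AE) (auto elim: eventually_mono)
    then show "distributed M lborel (\<lambda>\<omega>. X t \<omega> - X s \<omega>) (normal_density 0 (sqrt (t - s)))"
      using gaussian_increments[OF st] by (simp add: distributed_def)
  next
    have cont: "continuous_on UNIV (\<lambda>s. X s \<omega>)" for \<omega>
    proof (cases "\<omega> \<in> G")
      case True
      have "continuous_on UNIV (\<lambda>s. B (max 0 s) \<omega>)"
        by (rule continuous_on_compose2[OF good(2)[OF True]]) (auto intro!: continuous_intros)
      then show ?thesis using True by (simp add: X_def)
    qed (simp add: X_def)
    then show "continuous_on UNIV (\<lambda>s. X s \<omega>)" for \<omega> .
    show "AE \<omega> in M. continuous_on {0..} (\<lambda>t. X t \<omega>)"
      using cont by (intro AE_I2) (rule continuous_on_subset, auto)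
  next
    show "X s \<in> borel_measurable M" for s by (rule meas)
    show "X 0 \<omega> = 0" for \<omega> using good by (simp add: X_def)
  qed
  then show ?thesis using ae that by blast
qed

section \<open>The claimed law\<close>

text \<open>
  A measure with density on the plane whose image under \<open>(y, u) \<mapsto> (y, max 0 u)\<close> is the claimed
  law.  The strip \<open>-1 \<le> u < 0\<close> has unit width and is collapsed to \<open>u = 0\<close>, where it produces the
  atom.  By the reflection principle, the mass of the atom is the density of the paths that end in
  \<open>y\<close> without meeting the level \<open>a\<close>.
\<close>

definition lifted_law :: "real \<Rightarrow> real \<Rightarrow> (real \<times> real) measure" where
  "lifted_law a t = density (lborel \<Otimes>\<^sub>M lborel) (\<lambda>(y, u).
     if 0 \<le> u then ennreal (passage_density t (\<bar>a\<bar> + \<bar>y - a\<bar> + u))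
     else ennreal (heat_kernel t y - heat_kernel t (\<bar>a\<bar> + \<bar>y - a\<bar>)) * indicator {-1..<0::real} u)"

lemma sets_lifted_law [simp, measurable_cong]: "sets (lifted_law a t) = sets (borel \<Otimes>\<^sub>M borel)"
  unfolding lifted_law_def by (simp cong: sets_pair_measure_cong)

lemma nn_integral_lifted_law:
  assumes F [measurable]: "F \<in> borel_measurable (borel \<Otimes>\<^sub>M borel)"
  shows "(\<integral>\<^sup>+ p. F (fst p, max 0 (snd p)) \<partial>lifted_law a t) =
    (\<integral>\<^sup>+ y. (\<integral>\<^sup>+ v. F (y, v) * (ennreal (passage_density t (\<bar>a\<bar> + \<bar>y - a\<bar> + v)) * indicator {0..} v) \<partial>lborel)
       + F (y, 0) * ennreal (heat_kernel t y - heat_kernel t (\<bar>a\<bar> + \<bar>y - a\<bar>)) \<partial>lborel)"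
proof -
  let ?d = "\<lambda>(y, u). if 0 \<le> u then ennreal (passage_density t (\<bar>a\<bar> + \<bar>y - a\<bar> + u))
     else ennreal (heat_kernel t y - heat_kernel t (\<bar>a\<bar> + \<bar>y - a\<bar>)) * indicator {-1..<0::real} u"
  have d [measurable]: "?d \<in> borel_measurable (lborel \<Otimes>\<^sub>M lborel)" by (simp add: split_beta)
  have "(\<integral>\<^sup>+ p. F (fst p, max 0 (snd p)) \<partial>lifted_law a t) = (\<integral>\<^sup>+ p. ?d p * F (fst p, max 0 (snd p)) \<partial>(lborel \<Otimes>\<^sub>M lborel))"
    unfolding lifted_law_def by (rule nn_integral_density) (use d in auto)
  also have "\<dots> = (\<integral>\<^sup>+ y. (\<integral>\<^sup>+ u. ?d (y, u) * F (y, max 0 u) \<partial>lborel) \<partial>lborel)"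
    by (subst lborel.nn_integral_fst[symmetric]) (use d in \<open>auto simp del: prod.case\<close>)
  also have "\<dots> = (\<integral>\<^sup>+ y. (\<integral>\<^sup>+ v. F (y, v) * (ennreal (passage_density t (\<bar>a\<bar> + \<bar>y - a\<bar> + v)) * indicator {0..} v) \<partial>lborel)
       + F (y, 0) * ennreal (heat_kernel t y - heat_kernel t (\<bar>a\<bar> + \<bar>y - a\<bar>)) \<partial>lborel)"
  proof (intro nn_integral_cong)
    fix y
    let ?g = "ennreal (heat_kernel t y - heat_kernel t (\<bar>a\<bar> + \<bar>y - a\<bar>))"
    have [measurable]: "(\<lambda>u. F (y, u)) \<in> borel_measurable borel"
      by (rule measurable_compose[OF _ F]) simp
    have "(\<integral>\<^sup>+ u. ?d (y, u) * F (y, max 0 u) \<partial>lborel) = 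
      (\<integral>\<^sup>+ u. F (y, u) * (ennreal (passage_density t (\<bar>a\<bar> + \<bar>y - a\<bar> + u)) * indicator {0..} u) + F (y, 0) * ?g * indicator {-1..<0::real} u \<partial>lborel)"
      by (intro nn_integral_cong) (auto simp: indicator_def max_def mult_ac)
    also have "\<dots> = (\<integral>\<^sup>+ u. F (y, u) * (ennreal (passage_density t (\<bar>a\<bar> + \<bar>y - a\<bar> + u)) * indicator {0..} u) \<partial>lborel)
       + (\<integral>\<^sup>+ u. F (y, 0) * ?g * indicator {-1..<0::real} u \<partial>lborel)"
      by (rule nn_integral_add) auto
    also have "(\<integral>\<^sup>+ u. F (y, 0) * ?g * indicator {-1..<0::real} u \<partial>lborel) = F (y, 0) * ?g"
      by (subst nn_integral_cmult) auto
    finally show "(\<integral>\<^sup>+ u. ?d (y, u) * F (y, max 0 u) \<partial>lborel) = (\<integral>\<^sup>+ v. F (y, v) * (ennreal (passage_density t (\<bar>a\<bar> + \<bar>y - a\<bar> + v)) * indicator {0..} v) \<partial>lborel)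
       + F (y, 0) * ?g" .
  qed
  finally show ?thesis .
qed

lemma heat_kernel_image_le: "0 < t \<Longrightarrow> heat_kernel t (\<bar>a\<bar> + \<bar>y - a\<bar>) \<le> heat_kernel t y"
  using heat_kernel_antimono[of t "\<bar>y\<bar>" "\<bar>a\<bar> + \<bar>y - a\<bar>"] by (simp add: heat_kernel_abs)

text \<open>
  The atom contributes to the moment of order \<open>0\<close> alone, as \<open>0\<^sup>n = 0\<close> otherwise.
\<close>

lemma lifted_law_moments:
  assumes t: "0 < t" and A [measurable]: "A \<in> sets borel"
  shows "(\<integral>\<^sup>+ p. indicator A (fst p) * ennreal (max 0 (snd p) ^ n / fact n) \<partial>lifted_law a t)
    = (\<integral>\<^sup>+ y. indicator A y * limit_kernel a n t y \<partial>lborel)"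
proof -
  let ?r = "\<lambda>y. \<bar>a\<bar> + \<bar>y - a\<bar>"
  have "(\<integral>\<^sup>+ p. indicator A (fst p) * ennreal (max 0 (snd p) ^ n / fact n) \<partial>lifted_law a t)
    = (\<integral>\<^sup>+ p. (\<lambda>p. indicator A (fst p) * ennreal (snd p ^ n / fact n)) (fst p, max 0 (snd p)) \<partial>lifted_law a t)"
    by simp
  also have "\<dots> = (\<integral>\<^sup>+ y. (\<integral>\<^sup>+ v. indicator A y * ennreal (v ^ n / fact n) * (ennreal (passage_density t (?r y + v)) * indicator {0..} v) \<partial>lborel)
       + indicator A y * ennreal (0 ^ n / fact n) * ennreal (heat_kernel t y - heat_kernel t (?r y)) \<partial>lborel)"
    by (subst nn_integral_lifted_law) auto
  also have "\<dots> = (\<integral>\<^sup>+ y. indicator A y * limit_kernel a n t y \<partial>lborel)"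
  proof (intro nn_integral_cong)
    fix y
    have "(\<integral>\<^sup>+ v. indicator A y * ennreal (v ^ n / fact n) * (ennreal (passage_density t (?r y + v)) * indicator {0..} v) \<partial>lborel)
      = (\<integral>\<^sup>+ v. indicator A y * (ennreal (v ^ n / fact n * passage_density t (?r y + v)) * indicator {0..} v) \<partial>lborel)"
      by (intro nn_integral_cong) (auto simp: indicator_def ennreal_mult'[symmetric])
    also have "\<dots> = indicator A y * (\<integral>\<^sup>+ v. ennreal (v ^ n / fact n * passage_density t (?r y + v)) * indicator {0..} v \<partial>lborel)"
      by (rule nn_integral_cmult) simp
    also have "(\<integral>\<^sup>+ v. ennreal (v ^ n / fact n * passage_density t (?r y + v)) * indicator {0..} v \<partial>lborel) = heat_tail n t (?r y)"
      by (rule heat_tail_moment[OF t]) simp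
    finally have 1: "(\<integral>\<^sup>+ v. indicator A y * ennreal (v ^ n / fact n) * (ennreal (passage_density t (?r y + v)) * indicator {0..} v) \<partial>lborel)
      = indicator A y * heat_tail n t (?r y)" .
    have 2: "heat_tail n t (?r y) + ennreal (0 ^ n / fact n) * ennreal (heat_kernel t y - heat_kernel t (?r y)) = limit_kernel a n t y"
      using t heat_kernel_image_le[OF t, of a y] heat_kernel_nonneg[of t "?r y"]
      by (cases n) (auto simp: limit_kernel_def ennreal_plus[symmetric] simp del: ennreal_plus heat_tail.simps(2))
    show "(\<integral>\<^sup>+ v. indicator A y * ennreal (v ^ n / fact n) * (ennreal (passage_density t (?r y + v)) * indicator {0..} v) \<partial>lborel)
       + indicator A y * ennreal (0 ^ n / fact n) * ennreal (heat_kernel t y - heat_kernel t (?r y)) = indicator A y * limit_kernel a n t y"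
      unfolding 1 2[symmetric] by (simp only: distrib_left mult.assoc)
  qed
  finally show ?thesis .
qed

lemma finite_measure_lifted_law: "0 < t \<Longrightarrow> finite_measure (lifted_law a t)"
proof (rule finite_measureI)
  assume t: "0 < t"
  have "emeasure (lifted_law a t) (space (lifted_law a t)) = (\<integral>\<^sup>+ p. 1 \<partial>lifted_law a t)" by simp
  also have "\<dots> = 1"
    using lifted_law_moments[OF t, where A=UNIV and n=0 and a=a] nn_integral_heat_kernel[OF t] by (simp add: limit_kernel_def)
  finally show "emeasure (lifted_law a t) (space (lifted_law a t)) \<noteq> \<infinity>" by simp
qed

lemma char_lifted_law:
  assumes t: "0 < t" and A [measurable]: "A \<in> sets borel"
    and m: "\<And>n. 0 \<le> m n" "\<And>n. (\<integral>\<^sup>+ y. indicator A y * limit_kernel a n t y \<partial>lborel) = ennreal (m n)"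
    "summable (\<lambda>n. \<bar>\<eta>\<bar> ^ n * m n)"
  shows "(\<integral>p. iexp (\<eta> * max 0 (snd p)) \<partial>density (lifted_law a t) (\<lambda>p. indicator A (fst p)))
    = (\<Sum>n. (\<i> * of_real \<eta>) ^ n * of_real (m n))"
proof -
  have [measurable]: "(\<lambda>p. indicator A (fst p) :: ennreal) \<in> borel_measurable (lifted_law a t)"
    "(\<lambda>p. max 0 (snd p) :: real) \<in> borel_measurable (lifted_law a t)"
    by measurable
  have "(\<lambda>n. (\<i> * of_real \<eta>) ^ n * of_real (m n)) sums (\<integral>p. iexp (\<eta> * max 0 (snd p)) \<partial>density (lifted_law a t) (\<lambda>p. indicator A (fst p)))"
  proof (rule exp_moment_series)
    fix n
    show "(\<integral>\<^sup>+ p. ennreal (max 0 (snd p) ^ n / fact n) \<partial>density (lifted_law a t) (\<lambda>p. indicator A (fst p))) = ennreal (m n)"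
      using lifted_law_moments[OF t A, where n=n and a=a] by (subst nn_integral_density) (simp_all add: m)
  qed (use m in auto)
  then show ?thesis by (rule sums_unique)
qed

section \<open>The law of Brownian motion and its local time\<close>

definition tent :: "real \<Rightarrow> real \<Rightarrow> real \<Rightarrow> real" where
  "tent a \<epsilon> x = max 0 (1 - \<bar>x - a\<bar> / \<epsilon>) / \<epsilon>"

lemma tent_continuous: "0 < \<epsilon> \<Longrightarrow> continuous_on UNIV (tent a \<epsilon>)"
  unfolding tent_def by (intro continuous_intros) auto

lemma tent_bound: "0 < \<epsilon> \<Longrightarrow> tent a \<epsilon> x \<le> 1 / \<epsilon>"
  unfolding tent_def by (intro divide_right_mono) auto

lemma tent_bump:
  assumes "0 < \<epsilon>"
  shows "bump (tent a \<epsilon>) a \<epsilon>"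
proof
  show "tent a \<epsilon> \<in> borel_measurable borel"
    by (rule borel_measurable_continuous_onI[OF tent_continuous[OF assms]])
  show "0 \<le> tent a \<epsilon> x" for x using assms by (simp add: tent_def)
  show "tent a \<epsilon> x = 0" if "\<epsilon> < \<bar>x - a\<bar>" for x using that assms by (simp add: tent_def)
  have [measurable]: "tent a \<epsilon> \<in> borel_measurable borel"
    by (rule borel_measurable_continuous_onI[OF tent_continuous[OF assms]])
  have left: "(\<integral>\<^sup>+ u. ennreal (1 + u) * indicator {-1..0} u \<partial>lborel) = ennreal ((0 + 0\<^sup>2 / 2) - (-1 + (-1)\<^sup>2 / 2))"
    by (rule nn_integral_FTC_Icc) (auto intro!: derivative_eq_intros)
  have right: "(\<integral>\<^sup>+ u. ennreal (1 - u) * indicator {0..1} u \<partial>lborel) = ennreal ((1 - 1\<^sup>2 / 2) - (0 - 0\<^sup>2 / 2))"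
    by (rule nn_integral_FTC_Icc) (auto intro!: derivative_eq_intros)
  have "(\<integral>\<^sup>+ x. ennreal (tent a \<epsilon> x) \<partial>lborel) = ennreal \<epsilon> * (\<integral>\<^sup>+ u. ennreal (tent a \<epsilon> (a + \<epsilon> * u)) \<partial>lborel)"
    using assms by (subst nn_integral_real_affine[where c=\<epsilon> and t=a]) auto
  also have "\<dots> = (\<integral>\<^sup>+ u. ennreal \<epsilon> * ennreal (tent a \<epsilon> (a + \<epsilon> * u)) \<partial>lborel)"
    by (rule nn_integral_cmult[symmetric]) simp
  also have "\<dots> = (\<integral>\<^sup>+ u. ennreal (1 + u) * indicator {-1..0} u + ennreal (1 - u) * indicator {0..1} u \<partial>lborel)"
  proof (rule nn_integral_cong_AE)
    show "AE u in lborel. ennreal \<epsilon> * ennreal (tent a \<epsilon> (a + \<epsilon> * u)) = ennreal (1 + u) * indicator {-1..0} u + ennreal (1 - u) * indicator {0..1} u"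
      using AE_lborel_singleton[of 0]
    proof eventually_elim
      case (elim u)
      have "ennreal \<epsilon> * ennreal (tent a \<epsilon> (a + \<epsilon> * u)) = ennreal (max 0 (1 - \<bar>u\<bar>))"
        using assms by (simp add: tent_def ennreal_mult'[symmetric] abs_mult)
      then show ?case using elim by (auto simp: indicator_def max_def)
    qed
  qed
  also have "\<dots> = (\<integral>\<^sup>+ u. ennreal (1 + u) * indicator {-1..0} u \<partial>lborel) + (\<integral>\<^sup>+ u. ennreal (1 - u) * indicator {0..1} u \<partial>lborel)"
    by (rule nn_integral_add) auto
  also have "\<dots> = ennreal (((0 + 0\<^sup>2 / 2) - (-1 + (-1)\<^sup>2 / 2)) + ((1 - 1\<^sup>2 / 2) - (0 - 0\<^sup>2 / 2)))"
    unfolding left right by (rule ennreal_plus[symmetric]) auto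
  also have "\<dots> = 1" by simp
  finally show "(\<integral>\<^sup>+ x. ennreal (tent a \<epsilon> x) \<partial>lborel) = 1" .
qed (use assms in auto)

text \<open>
  The integral of \<open>\<phi> * l\<close> is an average of \<open>l\<close> over the \<open>\<epsilon>\<close>-neighbourhood of \<open>a\<close>.
\<close>

lemma (in bump) bump_integral_close:
  assumes int: "integrable lborel (\<lambda>x. \<phi> x * l x)" and close: "\<And>x. \<bar>x - a\<bar> \<le> \<epsilon> \<Longrightarrow> \<bar>l x - c\<bar> \<le> e"
  shows "\<bar>(\<integral>x. \<phi> x * l x \<partial>lborel) - c\<bar> \<le> e"
proof -
  have int\<phi>: "integrable lborel \<phi>" "(\<integral>x. \<phi> x \<partial>lborel) = 1"
  proof -
    show "integrable lborel \<phi>" by (rule integrableI_nonneg) (auto simp: bump_nonneg bump_mass)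
    show "(\<integral>x. \<phi> x \<partial>lborel) = 1"
      by (rule integral_eq_nn_integral[THEN trans]) (auto simp: bump_nonneg bump_mass)
  qed
  have "(\<integral>x. \<phi> x * l x \<partial>lborel) - c = (\<integral>x. \<phi> x * l x - \<phi> x * c \<partial>lborel)"
    using int int\<phi> by simp
  also have "\<bar>\<dots>\<bar> \<le> (\<integral>x. \<bar>\<phi> x * l x - \<phi> x * c\<bar> \<partial>lborel)"
    by (rule integral_abs_bound)
  also have "\<dots> \<le> (\<integral>x. \<phi> x * e \<partial>lborel)"
  proof (rule integral_mono)
    show "integrable lborel (\<lambda>x. \<bar>\<phi> x * l x - \<phi> x * c\<bar>)" using int int\<phi>(1) by simp
    show "integrable lborel (\<lambda>x. \<phi> x * e)" using int\<phi>(1) by simp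
    show "\<bar>\<phi> x * l x - \<phi> x * c\<bar> \<le> \<phi> x * e" for x
    proof (cases "\<epsilon> < \<bar>x - a\<bar>")
      case False
      then have "\<phi> x * \<bar>l x - c\<bar> \<le> \<phi> x * e" by (intro mult_left_mono close bump_nonneg) auto
      then show ?thesis using bump_nonneg[of x] by (simp add: right_diff_distrib[symmetric] abs_mult)
    qed (simp add: bump_support)
  qed
  also have "\<dots> = e" using int\<phi> by simp
  finally show ?thesis .
qed

context brownian_local_time
begin

text \<open>
  The occupation formula for the bump, combined with the continuity of local time in the level.
\<close>

lemma smoothed_occupation_tendsto:
  assumes t: "0 < t" and cont: "\<And>k. continuous_on UNIV (\<phi> k)" and bdd: "\<And>k x. \<phi> k x \<le> c k"
    and \<phi>: "\<And>k. bump (\<phi> k) a (\<epsilon> k)" and \<epsilon>: "\<epsilon> \<longlonglongrightarrow> 0"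
  shows "AE \<omega> in M. (\<lambda>k. LBINT r:{0..t}. \<phi> k (B r \<omega>)) \<longlonglongrightarrow> L t a \<omega>"
  using continuous_L occupation_formula
proof eventually_elim
  case (elim \<omega>)
  have "continuous_on UNIV ((\<lambda>(t, a). L t a \<omega>) \<circ> Pair t)"
    by (rule continuous_on_compose[OF _ continuous_on_subset[OF elim(1)]])
       (use t in \<open>auto intro!: continuous_intros\<close>)
  then have "continuous_on UNIV (\<lambda>x. L t x \<omega>)" by (simp add: comp_def)
  then have "isCont (\<lambda>x. L t x \<omega>) a" by (simp add: continuous_on_eq_continuous_at)
  show ?case
  proof (rule LIMSEQ_I)
    fix e :: real assume "0 < e"
    with \<open>isCont (\<lambda>x. L t x \<omega>) a\<close> obtain d where d: "d > 0" "\<And>x. \<bar>x - a\<bar> < d \<Longrightarrow> \<bar>L t x \<omega> - L t a \<omega>\<bar> < e / 2"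
      unfolding continuous_at_eps_delta dist_real_def by (metis half_gt_zero)
    from order_tendstoD(2)[OF \<epsilon> d(1)] obtain k0 where k0: "\<And>k. k0 \<le> k \<Longrightarrow> \<epsilon> k < d"
      unfolding eventually_sequentially by auto
    show "\<exists>k0. \<forall>k\<ge>k0. norm ((LBINT r:{0..t}. \<phi> k (B r \<omega>)) - L t a \<omega>) < e"
    proof (intro exI allI impI)
      fix k assume "k0 \<le> k"
      interpret bump "\<phi> k" a "\<epsilon> k" by (rule \<phi>)
      have "bounded (range (\<phi> k))"
        using bdd bump_nonneg by (intro boundedI[of _ "c k"]) auto
      then have hb: "has_bochner_integral lborel (\<lambda>x. \<phi> k x * L t x \<omega>) (LBINT r:{0..t}. \<phi> k (B r \<omega>))"
        using elim(2) t bump_measurable by auto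
      have "\<bar>(\<integral>x. \<phi> k x * L t x \<omega> \<partial>lborel) - L t a \<omega>\<bar> \<le> e / 2"
      proof (rule bump_integral_close)
        show "integrable lborel (\<lambda>x. \<phi> k x * L t x \<omega>)" using hb by (simp add: has_bochner_integral_iff)
        show "\<bar>L t x \<omega> - L t a \<omega>\<bar> \<le> e / 2" if "\<bar>x - a\<bar> \<le> \<epsilon> k" for x
          using d(2)[of x] that k0[OF \<open>k0 \<le> k\<close>] by simp
      qed
      then show "norm ((LBINT r:{0..t}. \<phi> k (B r \<omega>)) - L t a \<omega>) < e"
        using \<open>0 < e\<close> by (simp add: has_bochner_integral_integral_eq[OF hb])
    qed
  qed
qed

text \<open>
  Both sides are the sum of the same moment series: the left side as the limit of the occupation
  times of shrinking tents, the right side because the claimed law has these moments.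
\<close>

lemma char_local_time:
  assumes t: "0 < t" and A [measurable]: "A \<in> sets borel"
  shows "(\<integral>\<omega>. iexp (\<eta> * L t a \<omega>) \<partial>density M (\<lambda>\<omega>. indicator A (B t \<omega>))) =
    (\<integral>p. iexp (\<eta> * max 0 (snd p)) \<partial>density (lifted_law a t) (\<lambda>p. indicator A (fst p)))"
proof -
  obtain X where X: "continuous_brownian_motion M X" and ae: "AE \<omega> in M. \<forall>s\<ge>0. X s \<omega> = B s \<omega>"
    by (rule continuous_modification)
  interpret X: continuous_brownian_motion M X by (rule X)
  have [measurable]: "B t \<in> borel_measurable M" "L t a \<in> borel_measurable M"
    using t by (auto intro: random_variable_B random_variable_L)
  define \<epsilon> where "\<epsilon> = (\<lambda>k. 1 / (2 * real (Suc k)))"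
  have \<epsilon>_pos: "0 < \<epsilon> k" and \<epsilon>_le: "\<epsilon> k \<le> 1 / 2" for k
    by (simp_all add: \<epsilon>_def field_simps)
  have \<epsilon>_lim: "\<epsilon> \<longlonglongrightarrow> 0" unfolding \<epsilon>_def by real_asymp
  define \<phi> where "\<phi> = (\<lambda>k. tent a (\<epsilon> k))"
  have cont: "continuous_on UNIV (\<phi> k)" and bdd: "\<phi> k x \<le> 1 / \<epsilon> k" and bump: "bump (\<phi> k) a (\<epsilon> k)" for k x
    unfolding \<phi>_def using \<epsilon>_pos[of k] by (auto intro: tent_continuous tent_bound tent_bump)
  have [measurable]: "\<phi> k \<in> borel_measurable borel" for k using bump[of k] by (simp add: bump_def)
  obtain m where m: "\<And>n. 0 \<le> m n" "\<And>n. (\<integral>\<^sup>+ y. indicator A y * limit_kernel a n t y \<partial>lborel) = ennreal (m n)"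
    "summable (\<lambda>n. \<bar>\<eta>\<bar> ^ n * m n)"
    and lim: "(\<lambda>k. \<integral>\<omega>. iexp (\<eta> * X.occupation (\<phi> k) t \<omega>) \<partial>density M (\<lambda>\<omega>. indicator A (X t \<omega>))) 
       \<longlonglongrightarrow> (\<Sum>n. (\<i> * of_real \<eta>) ^ n * of_real (m n))"
    by (rule X.char_occupation_tendsto[OF t A cont bdd bump \<epsilon>_lim \<epsilon>_le]) blast
  have dens: "density M (\<lambda>\<omega>. indicator A (X t \<omega>) :: ennreal) = density M (\<lambda>\<omega>. indicator A (B t \<omega>))"
    using ae t by (intro density_cong) (auto elim: eventually_mono)
  let ?D = "density M (\<lambda>\<omega>. indicator A (B t \<omega>) :: ennreal)"
  have fin: "finite_measure ?D"
  proof (rule finite_measureI)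
    have "emeasure ?D (space M) = (\<integral>\<^sup>+ \<omega>. indicator A (B t \<omega>) * indicator (space M) \<omega> \<partial>M)"
      by (rule emeasure_density) measurable
    also have "\<dots> \<le> (\<integral>\<^sup>+ \<omega>. 1 \<partial>M)" by (intro nn_integral_mono) (auto simp: indicator_def)
    also have "\<dots> < \<infinity>" by (simp add: emeasure_space_1)
    finally show "emeasure ?D (space ?D) \<noteq> \<infinity>" by simp
  qed
  interpret D: finite_measure ?D by (rule fin)
  have "AE \<omega> in M. (\<lambda>k. X.occupation (\<phi> k) t \<omega>) \<longlonglongrightarrow> L t a \<omega>"
    using smoothed_occupation_tendsto[OF t cont bdd bump \<epsilon>_lim] ae
  proof eventually_elim
    case (elim \<omega>)
    have "X.occupation (\<phi> k) t \<omega> = (LBINT r:{0..t}. \<phi> k (B r \<omega>))" for k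
      unfolding X.occupation_def using elim(2) by (intro set_lebesgue_integral_cong) auto
    then show ?case using elim(1) by simp
  qed
  then have occ_lim: "AE \<omega> in ?D. (\<lambda>k. X.occupation (\<phi> k) t \<omega>) \<longlonglongrightarrow> L t a \<omega>"
    by (subst AE_density) (auto elim: eventually_mono)
  have "(\<lambda>k. \<integral>\<omega>. iexp (\<eta> * X.occupation (\<phi> k) t \<omega>) \<partial>?D) \<longlonglongrightarrow> (\<integral>\<omega>. iexp (\<eta> * L t a \<omega>) \<partial>?D)"
  proof (rule integral_dominated_convergence[where w="\<lambda>_. 1"])
    show "AE \<omega> in ?D. (\<lambda>k. iexp (\<eta> * X.occupation (\<phi> k) t \<omega>)) \<longlonglongrightarrow> iexp (\<eta> * L t a \<omega>)"
      using occ_lim by eventually_elim (intro tendsto_intros)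
  qed auto
  then have "(\<integral>\<omega>. iexp (\<eta> * L t a \<omega>) \<partial>?D) = (\<Sum>n. (\<i> * of_real \<eta>) ^ n * of_real (m n))"
    using lim unfolding dens by (rule LIMSEQ_unique)
  also have "\<dots> = (\<integral>p. iexp (\<eta> * max 0 (snd p)) \<partial>density (lifted_law a t) (\<lambda>p. indicator A (fst p)))"
    by (rule char_lifted_law[OF t A m, symmetric])
  finally show ?thesis .
qed

lemma distr_position_local_time:
  assumes t: "0 < t"
  shows "distr M borel (\<lambda>\<omega>. (B t \<omega>, L t a \<omega>)) = distr (lifted_law a t) borel (\<lambda>p. (fst p, max 0 (snd p)))"
proof -
  have "distr M (borel \<Otimes>\<^sub>M borel) (\<lambda>\<omega>. (B t \<omega>, L t a \<omega>)) = distr (lifted_law a t) (borel \<Otimes>\<^sub>M borel) (\<lambda>p. (fst p, max 0 (snd p)))"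
  proof (rule joint_distr_eqI_char)
    show "finite_measure M" by (rule finite_measure_axioms)
    show "finite_measure (lifted_law a t)" by (rule finite_measure_lifted_law[OF t])
    show "B t \<in> borel_measurable M" "L t a \<in> borel_measurable M"
      using t by (auto intro: random_variable_B random_variable_L)
    show "fst \<in> borel_measurable (lifted_law a t)" "(\<lambda>p. max 0 (snd p)) \<in> borel_measurable (lifted_law a t)"
      by measurable
  qed (rule char_local_time[OF t])
  then show ?thesis by (simp only: borel_prod)
qed

end

theorem theorem2p8:
  fixes M :: "'w measure" and B :: "real \<Rightarrow> 'w \<Rightarrow> real"
    and L :: "real \<Rightarrow> real \<Rightarrow> 'w \<Rightarrow> real" and t a :: real
  assumes "brownian_local_time M B L" and "t > 0"
  shows "\<forall>A \<in> sets (borel :: (real \<times> real) measure).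
    emeasure (distr M borel (\<lambda>\<omega>. (B t \<omega>, L t a \<omega>))) A =
      (\<integral>\<^sup>+ y.
        (\<integral>\<^sup>+ v. indicator A (y, v) * ennreal (indicator {0..} v *
            ((\<bar>a\<bar> + \<bar>y - a\<bar> + v) / sqrt (2 * pi * t ^ 3) *
              exp (- (\<bar>a\<bar> + \<bar>y - a\<bar> + v)\<^sup>2 / (2 * t)))) \<partial>lborel) +
        (\<integral>\<^sup>+ v. indicator A (y, v) * ennreal (indicator {0..} v *
            (1 / sqrt (2 * pi * t) *
              (exp (- y\<^sup>2 / (2 * t)) - exp (- (2 * a - y)\<^sup>2 / (2 * t))) *
              of_bool (level_sign a * y \<le> \<bar>a\<bar>))) \<partial>(return borel 0))
        \<partial>lborel)"
proof
  fix A :: "(real \<times> real) set" assume A: "A \<in> sets borel"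
  interpret brownian_local_time M B L by (rule assms(1))
  have A' [measurable]: "A \<in> sets (borel \<Otimes>\<^sub>M borel)" using A by (simp only: borel_prod)
  have slice [measurable]: "{v. (y, v) \<in> A} \<in> sets borel" for y
    using sets_Pair1[OF A', of y] by (simp add: vimage_def)
  have "emeasure (distr M borel (\<lambda>\<omega>. (B t \<omega>, L t a \<omega>))) A = emeasure (distr (lifted_law a t) borel (\<lambda>p. (fst p, max 0 (snd p)))) A"
    by (simp only: distr_position_local_time[OF assms(2)])
  also have "\<dots> = (\<integral>\<^sup>+ q. indicator A q \<partial>distr (lifted_law a t) borel (\<lambda>p. (fst p, max 0 (snd p))))"
    using A by simp
  also have "\<dots> = (\<integral>\<^sup>+ p. indicator A (fst p, max 0 (snd p)) \<partial>lifted_law a t)"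
    by (rule nn_integral_distr) (use A in \<open>auto simp: borel_prod[symmetric]\<close>)
  also have "\<dots> = (\<integral>\<^sup>+ y. (\<integral>\<^sup>+ v. indicator A (y, v) * (ennreal (passage_density t (\<bar>a\<bar> + \<bar>y - a\<bar> + v)) * indicator {0..} v) \<partial>lborel)
       + indicator A (y, 0) * ennreal (heat_kernel t y - heat_kernel t (\<bar>a\<bar> + \<bar>y - a\<bar>)) \<partial>lborel)"
    by (rule nn_integral_lifted_law) simp
  also have "\<dots> = (\<integral>\<^sup>+ y.
        (\<integral>\<^sup>+ v. indicator A (y, v) * ennreal (indicator {0..} v *
            ((\<bar>a\<bar> + \<bar>y - a\<bar> + v) / sqrt (2 * pi * t ^ 3) *
              exp (- (\<bar>a\<bar> + \<bar>y - a\<bar> + v)\<^sup>2 / (2 * t)))) \<partial>lborel) +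
        (\<integral>\<^sup>+ v. indicator A (y, v) * ennreal (indicator {0..} v *
            (1 / sqrt (2 * pi * t) *
              (exp (- y\<^sup>2 / (2 * t)) - exp (- (2 * a - y)\<^sup>2 / (2 * t))) *
              of_bool (level_sign a * y \<le> \<bar>a\<bar>))) \<partial>(return borel 0))
        \<partial>lborel)"
  proof (intro nn_integral_cong arg_cong2[where f="(+)"])
    fix y v :: real
    have "sqrt (2 * pi * t ^ 3) = t * sqrt (2 * pi * t)"
      using assms(2) by (simp add: real_sqrt_mult power3_eq_cube)
    then have "passage_density t x = x / sqrt (2 * pi * t ^ 3) * exp (- x\<^sup>2 / (2 * t))" for x
      by (simp add: passage_density_def heat_kernel_def)
    then show "indicator A (y, v) * (ennreal (passage_density t (\<bar>a\<bar> + \<bar>y - a\<bar> + v)) * indicator {0..} v) =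
      indicator A (y, v) * ennreal (indicator {0..} v * ((\<bar>a\<bar> + \<bar>y - a\<bar> + v) / sqrt (2 * pi * t ^ 3) *
              exp (- (\<bar>a\<bar> + \<bar>y - a\<bar> + v)\<^sup>2 / (2 * t))))"
      by (simp add: indicator_def)
  next
    fix y :: real
    \<comment> \<open>The length \<open>\<bar>a\<bar> + \<bar>y - a\<bar>\<close> is the distance from \<open>0\<close> to the mirror image of \<open>y\<close> at \<open>a\<close> if
      \<open>y\<close> lies on the same side of \<open>a\<close> as \<open>0\<close>, and it is \<open>\<bar>y\<bar>\<close> otherwise, where the atom vanishes.\<close>
    have image: "heat_kernel t (\<bar>a\<bar> + \<bar>y - a\<bar>) = (if level_sign a * y \<le> \<bar>a\<bar> then heat_kernel t (2 * a - y) else heat_kernel t y)"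
    proof (cases "level_sign a * y \<le> \<bar>a\<bar>")
      case True
      then have "\<bar>a\<bar> + \<bar>y - a\<bar> = 2 * a - y \<or> \<bar>a\<bar> + \<bar>y - a\<bar> = - (2 * a - y)"
        by (auto simp: level_sign_def split: if_splits)
      then show ?thesis using True heat_kernel_minus[of t "2 * a - y"] by auto
    next
      case False
      then have "\<bar>a\<bar> + \<bar>y - a\<bar> = \<bar>y\<bar>" by (auto simp: level_sign_def split: if_splits)
      then show ?thesis using False by (simp add: heat_kernel_abs)
    qed
    have "heat_kernel t y - heat_kernel t (\<bar>a\<bar> + \<bar>y - a\<bar>) = 1 / sqrt (2 * pi * t) *
              (exp (- y\<^sup>2 / (2 * t)) - exp (- (2 * a - y)\<^sup>2 / (2 * t))) * of_bool (level_sign a * y \<le> \<bar>a\<bar>)"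
      unfolding image by (simp add: heat_kernel_def diff_divide_distrib)
    then show "indicator A (y, 0) * ennreal (heat_kernel t y - heat_kernel t (\<bar>a\<bar> + \<bar>y - a\<bar>)) =
       (\<integral>\<^sup>+ v. indicator A (y, v) * ennreal (indicator {0..} v *
            (1 / sqrt (2 * pi * t) *
              (exp (- y\<^sup>2 / (2 * t)) - exp (- (2 * a - y)\<^sup>2 / (2 * t))) *
              of_bool (level_sign a * y \<le> \<bar>a\<bar>))) \<partial>(return borel 0))"
      by (subst nn_integral_return) (simp_all add: indicator_def)
  qed
  finally show "emeasure (distr M borel (\<lambda>\<omega>. (B t \<omega>, L t a \<omega>))) A = \<dots>" .
qed

end
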